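(* For every positive integer $n$, the map $\Phi_{\mathcal{P}}$ is a bijection from $\mathcal{T}_n$ (Baxter tree-like tableaux of size $n$) onto $\mathcal{P}_n$ (triples of non-intersecting lattice paths of size $n$).
   Context: Ferrers diagrams are drawn in English notation. A tree-like tableau (TLT) is a nonempty Ferrers diagram each of whose cells is empty or pointed, such that: (1) the top-left cell is pointed (the root); (2) every non-root pointed cell $c$ has a pointed cell above it in its column or to its left in its row, but not both; the nearest such pointed cell is its parent; (3) every row and column contains a pointed cell. The size is the number of points. The underlying binary tree $B(T)$ has the points as vertices, rooted at the root point; a point whose parent lies above it is the left child of the parent, one whose parent lies to its left is the right child. A TLT contains pattern H if there are rows $r_1$ above $r_2$ and columns $c_1<c_2<c_3$ with all six cells $(r_a,c_b)$ in the diagram such that $(r_1,c_2),(r_2,c_1),(r_2,c_3)$ are pointed and $(r_1,c_3),(r_2,c_2)$ empty; pattern V if there are rows $r_1$ above $r_2$ above $r_3$ and columns $c_1<c_2$ with all six cells in the diagram such that $(r_1,c_2),(r_2,c_1),(r_3,c_2)$ are pointed and $(r_2,c_2),(r_3,c_1)$ empty. A Baxter TLT avoids H and V; $\mathcal{T}_n$ is the set of Baxter TLTs of size $n$. Encoding binary trees: for a binary tree $B$ (each vertex has at most one left and at most one right child), let $B_c$ be obtained by giving every vertex of $B$ a new leaf in place of each missing child. Perform the depth-first traversal of $B_c$ from the root, exploring left subtrees before right subtrees, and build a word $w(B)$ over $\{L_\ell,L_r,E_\ell,E_r\}$: each time a leaf of $B_c$ that is a left (resp. right) child is first reached append $L_\ell$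 (resp. $L_r$), except for the first and the last leaves reached, for which nothing is appended; each time an edge between two vertices of $B$ going to a left (resp. right) child is first traversed append $E_\ell$ (resp. $E_r$). $w_1(B)$ is obtained from $w(B)$ by deleting $L_\ell,L_r$ and replacing $E_\ell\mapsto N$, $E_r\mapsto E$; $w_2(B)$ by deleting $E_\ell,E_r$ and replacing $L_\ell\mapsto E$, $L_r\mapsto N$. Words in $N,E$ are read as lattice paths with unit steps $N=(0,1)$, $E=(1,0)$. A triple of non-intersecting lattice paths of size $n$ is a set of three lattice paths with $N$ and $E$ unit steps, pairwise having no common point, starting respectively at $(1,0)$, $(0,1)$, $(-1,2)$ and ending respectively at $(n-i,i)$, $(n-i-1,i+1)$, $(n-i-2,i+2)$ for some $i\in\{0,\dots,n-1\}$; $\mathcal{P}_n$ is the set of them. The map $\Phi_{\mathcal{P}}$: for $T\in\mathcal{T}_n$, $\Phi_{\mathcal{P}}(T)$ is the triple consisting of $w_1(B(T))$ started at $(-1,2)$, $w_2(B(T))$ started at $(0,1)$, and the path started at $(1,0)$ given by the south-east border of the Ferrers diagram of $T$ (traversed from its bottom-left corner to its top-right corner, horizontal unit steps written $E$ and vertical ones $N$) with its first and its last step removed. *)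

theory Defs
  imports "HOL-Library.Tree"
begin

section \<open>Tree-like tableaux\<close>

text \<open>Cells are pairs (row, column), numbered from 0; rows are numbered downwards and columns
  from left to right (English notation), so the top-left cell is \<open>(0, 0)\<close>.\<close>

type_synonym cell = "nat \<times> nat"

datatype tableau = Tableau (cells: "cell set") (points: "cell set")

definition ferrers :: "cell set \<Rightarrow> bool" where
  "ferrers D \<longleftrightarrow> finite D \<and>
     (\<forall>r c r' c'. (r, c) \<in> D \<and> r' \<le> r \<and> c' \<le> c \<longrightarrow> (r', c') \<in> D)"

definition points_above :: "tableau \<Rightarrow> cell \<Rightarrow> cell set" where
  "points_above T p = {q \<in> points T. snd q = snd p \<and> fst q < fst p}"

definition points_left :: "tableau \<Rightarrow> cell \<Rightarrow> cell set" where
  "points_left T p = {q \<in> points T. fst q = fst p \<and> snd q < snd p}"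

definition tlt :: "tableau \<Rightarrow> bool" where
  "tlt T \<longleftrightarrow>
     ferrers (cells T) \<and> cells T \<noteq> {} \<and> points T \<subseteq> cells T \<and>
     (0, 0) \<in> points T \<and>
     (\<forall>p \<in> points T. p \<noteq> (0, 0) \<longrightarrow>
        (points_above T p \<noteq> {} \<or> points_left T p \<noteq> {}) \<and>
        \<not> (points_above T p \<noteq> {} \<and> points_left T p \<noteq> {})) \<and>
     (\<forall>r \<in> fst ` cells T. \<exists>c. (r, c) \<in> points T) \<and>
     (\<forall>c \<in> snd ` cells T. \<exists>r. (r, c) \<in> points T)"

definition contains_H :: "tableau \<Rightarrow> bool" where
  "contains_H T \<longleftrightarrow> (\<exists>r1 r2 c1 c2 c3. r1 < r2 \<and> c1 < c2 \<and> c2 < c3 \<and>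
     {(r1, c1), (r1, c2), (r1, c3), (r2, c1), (r2, c2), (r2, c3)} \<subseteq> cells T \<and>
     (r1, c2) \<in> points T \<and> (r2, c1) \<in> points T \<and> (r2, c3) \<in> points T \<and>
     (r1, c3) \<notin> points T \<and> (r2, c2) \<notin> points T)"

definition contains_V :: "tableau \<Rightarrow> bool" where
  "contains_V T \<longleftrightarrow> (\<exists>r1 r2 r3 c1 c2. r1 < r2 \<and> r2 < r3 \<and> c1 < c2 \<and>
     {(r1, c1), (r1, c2), (r2, c1), (r2, c2), (r3, c1), (r3, c2)} \<subseteq> cells T \<and>
     (r1, c2) \<in> points T \<and> (r2, c1) \<in> points T \<and> (r3, c2) \<in> points T \<and>
     (r2, c2) \<notin> points T \<and> (r3, c1) \<notin> points T)"

definition baxter_tlts :: "nat \<Rightarrow> tableau set" where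
  "baxter_tlts n =
     {T. tlt T \<and> card (points T) = n \<and> \<not> contains_H T \<and> \<not> contains_V T}"


section \<open>The underlying binary tree\<close>

definition parent_above :: "tableau \<Rightarrow> cell \<Rightarrow> cell \<Rightarrow> bool" where
  "parent_above T p q \<longleftrightarrow>
     q \<in> points_above T p \<and> (\<forall>q' \<in> points_above T p. fst q' \<le> fst q)"

definition parent_left :: "tableau \<Rightarrow> cell \<Rightarrow> cell \<Rightarrow> bool" where
  "parent_left T p q \<longleftrightarrow>
     q \<in> points_left T p \<and> (\<forall>q' \<in> points_left T p. snd q' \<le> snd q)"

definition left_child :: "tableau \<Rightarrow> cell \<Rightarrow> cell option" where
  "left_child T q =
     (if \<exists>p \<in> points T. parent_above T p q
      then Some (THE p. p \<in> points T \<and> parent_above T p q) else None)"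

definition right_child :: "tableau \<Rightarrow> cell \<Rightarrow> cell option" where
  "right_child T q =
     (if \<exists>p \<in> points T. parent_left T p q
      then Some (THE p. p \<in> points T \<and> parent_left T p q) else None)"

lemma left_childD:
  assumes "left_child T q = Some p"
  shows "p \<in> points T" "parent_above T p q"
proof -
  obtain a where a: "a \<in> points T" "parent_above T a q"
    using assms by (auto simp: left_child_def split: if_splits)
  have "\<exists>!p. p \<in> points T \<and> parent_above T p q"
  proof (rule ex1I)
    show "a \<in> points T \<and> parent_above T a q" using a by simp
    fix b assume b: "b \<in> points T \<and> parent_above T b q"
    have q: "snd a = snd q" "fst q < fst a" "snd b = snd q" "fst q < fst b"
      using a b by (auto simp: parent_above_def points_above_def)
    have "\<not> fst a < fst b"
    proof
      assume "fst a < fst b"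
      then have "a \<in> points_above T b" using a q by (simp add: points_above_def)
      then have "fst a \<le> fst q" using b by (simp add: parent_above_def)
      then show False using q by simp
    qed
    moreover have "\<not> fst b < fst a"
    proof
      assume "fst b < fst a"
      then have "b \<in> points_above T a" using b q by (simp add: points_above_def)
      then have "fst b \<le> fst q" using a by (simp add: parent_above_def)
      then show False using q by simp
    qed
    ultimately show "b = a" using q by (simp add: prod_eq_iff)
  qed
  from theI'[OF this] assms show "p \<in> points T" "parent_above T p q"
    by (auto simp: left_child_def split: if_splits)
qed

lemma right_childD:
  assumes "right_child T q = Some p"
  shows "p \<in> points T" "parent_left T p q"
proof -
  obtain a where a: "a \<in> points T" "parent_left T a q"
    using assms by (auto simp: right_child_def split: if_splits)
  have "\<exists>!p. p \<in> points T \<and> parent_left T p q"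
  proof (rule ex1I)
    show "a \<in> points T \<and> parent_left T a q" using a by simp
    fix b assume b: "b \<in> points T \<and> parent_left T b q"
    have q: "fst a = fst q" "snd q < snd a" "fst b = fst q" "snd q < snd b"
      using a b by (auto simp: parent_left_def points_left_def)
    have "\<not> snd a < snd b"
    proof
      assume "snd a < snd b"
      then have "a \<in> points_left T b" using a q by (simp add: points_left_def)
      then have "snd a \<le> snd q" using b by (simp add: parent_left_def)
      then show False using q by simp
    qed
    moreover have "\<not> snd b < snd a"
    proof
      assume "snd b < snd a"
      then have "b \<in> points_left T a" using b q by (simp add: points_left_def)
      then have "snd b \<le> snd q" using a by (simp add: parent_left_def)
      then show False using q by simp
    qed
    ultimately show "b = a" using q by (simp add: prod_eq_iff)
  qed
  from theI'[OF this] assms show "p \<in> points T" "parent_left T p q"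
    by (auto simp: right_child_def split: if_splits)
qed

text \<open>The tree of descendants of a point. The finiteness test, always true for a tree-like
  tableau, only serves to make the recursion total.\<close>

function descendants :: "tableau \<Rightarrow> cell \<Rightarrow> cell tree" where
  "descendants T p =
     (if finite (points T) then
        Node (case left_child T p of None \<Rightarrow> Leaf | Some q \<Rightarrow> descendants T q)
             p
             (case right_child T p of None \<Rightarrow> Leaf | Some q \<Rightarrow> descendants T q)
      else Leaf)"
  by pat_completeness auto
termination
proof (relation "measure (\<lambda>(T, p). card {q \<in> points T. fst p + snd p < fst q + snd q})")
  fix T p q assume fin: "finite (points T)" and "left_child T p = Some q"
  then have "q \<in> points T" "fst p + snd p < fst q + snd q"
    using left_childD[of T p q] by (auto simp: parent_above_def points_above_def)
  then have "{s \<in> points T. fst q + snd q < fst s + snd s} \<subset>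
             {s \<in> points T. fst p + snd p < fst s + snd s}" by auto
  then show "((T, q), T, p) \<in>
      measure (\<lambda>(T, p). card {q \<in> points T. fst p + snd p < fst q + snd q})"
    using fin by (auto intro: psubset_card_mono)
next
  fix T p q assume fin: "finite (points T)" and "right_child T p = Some q"
  then have "q \<in> points T" "fst p + snd p < fst q + snd q"
    using right_childD[of T p q] by (auto simp: parent_left_def points_left_def)
  then have "{s \<in> points T. fst q + snd q < fst s + snd s} \<subset>
             {s \<in> points T. fst p + snd p < fst s + snd s}" by auto
  then show "((T, q), T, p) \<in>
      measure (\<lambda>(T, p). card {q \<in> points T. fst p + snd p < fst q + snd q})"
    using fin by (auto intro: psubset_card_mono)
qed simp

declare descendants.simps [simp del]

definition binary_tree :: "tableau \<Rightarrow> cell tree" where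
  "binary_tree T = descendants T (0, 0)"


section \<open>Encoding binary trees by words\<close>

datatype letter = L_left | L_right | E_left | E_right

text \<open>A binary tree \<open>B\<close> is a value of the library type of trees whose vertices are the
  \<^const>\<open>Node\<close>s; the \<^const>\<open>Leaf\<close>s are then exactly the leaves added in the completed tree
  \<open>B\<^sub>c\<close>. The word \<open>traversal B\<close> still records all leaves of \<open>B\<^sub>c\<close>.\<close>

fun traversal :: "'a tree \<Rightarrow> letter list" where
  "traversal Leaf = []"
| "traversal (Node l v r) =
     (if l = Leaf then [L_left] else E_left # traversal l) @
     (if r = Leaf then [L_right] else E_right # traversal r)"

definition delete_first :: "('a \<Rightarrow> bool) \<Rightarrow> 'a list \<Rightarrow> 'a list" where
  "delete_first P xs = takeWhile (\<lambda>x. \<not> P x) xs @ tl (dropWhile (\<lambda>x. \<not> P x) xs)"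

definition delete_last :: "('a \<Rightarrow> bool) \<Rightarrow> 'a list \<Rightarrow> 'a list" where
  "delete_last P xs = rev (delete_first P (rev xs))"

definition is_leaf_letter :: "letter \<Rightarrow> bool" where
  "is_leaf_letter x \<longleftrightarrow> x = L_left \<or> x = L_right"

definition word :: "'a tree \<Rightarrow> letter list" where
  "word B = delete_last is_leaf_letter (delete_first is_leaf_letter (traversal B))"

datatype step = North | East

definition word1 :: "'a tree \<Rightarrow> step list" where
  "word1 B = map (\<lambda>x. if x = E_left then North else East)
     (filter (\<lambda>x. \<not> is_leaf_letter x) (word B))"

definition word2 :: "'a tree \<Rightarrow> step list" where
  "word2 B = map (\<lambda>x. if x = L_left then East else North)
     (filter is_leaf_letter (word B))"


section \<open>Lattice paths\<close>

text \<open>A lattice path is given by its starting point and its sequence of steps.\<close>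

type_synonym path = "(int \<times> int) \<times> step list"

fun move :: "int \<times> int \<Rightarrow> step \<Rightarrow> int \<times> int" where
  "move (x, y) North = (x, y + 1)"
| "move (x, y) East = (x + 1, y)"

definition path_end :: "path \<Rightarrow> int \<times> int" where
  "path_end p = foldl move (fst p) (snd p)"

definition path_points :: "path \<Rightarrow> (int \<times> int) set" where
  "path_points p = {foldl move (fst p) (take k (snd p)) | k. k \<le> length (snd p)}"

text \<open>The three paths are listed in the order of their starting points
  \<open>(1, 0)\<close>, \<open>(0, 1)\<close>, \<open>(-1, 2)\<close>. For paths with unit North and East steps, having a common
  point amounts to having a common lattice point.\<close>

definition nonintersecting_triples :: "nat \<Rightarrow> (path \<times> path \<times> path) set" where
  "nonintersecting_triples n = {(p, q, r).
     path_points p \<inter> path_points q = {} \<and>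
     path_points p \<inter> path_points r = {} \<and>
     path_points q \<inter> path_points r = {} \<and>
     fst p = (1, 0) \<and> fst q = (0, 1) \<and> fst r = (-1, 2) \<and>
     (\<exists>i \<in> {0..<n}.
        path_end p = (int n - int i, int i) \<and>
        path_end q = (int n - int i - 1, int i + 1) \<and>
        path_end r = (int n - int i - 2, int i + 2))}"


section \<open>The map\<close>

definition row_length :: "cell set \<Rightarrow> nat \<Rightarrow> nat" where
  "row_length D r = card {c. (r, c) \<in> D}"

definition num_rows :: "cell set \<Rightarrow> nat" where
  "num_rows D = card (fst ` D)"

text \<open>The south-east border from the bottom-left to the top-right corner, row by row from the
  bottom: below row \<open>r\<close> the border runs along the cells of row \<open>r\<close> that have no cell under
  them, then up the right side of row \<open>r\<close>.\<close>

definition se_border :: "cell set \<Rightarrow> step list" where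
  "se_border D = concat (map
     (\<lambda>r. replicate (row_length D r - row_length D (Suc r)) East @ [North])
     (rev [0..<num_rows D]))"

definition Phi_P :: "tableau \<Rightarrow> path \<times> path \<times> path" where
  "Phi_P T =
     (((1, 0), butlast (tl (se_border (cells T)))),
      ((0, 1), word2 (binary_tree T)),
      ((-1, 2), word1 (binary_tree T)))"

end

theory Submission
  imports Defs
begin

text \<open>Give the vertex \<open>v\<close> of a binary tree the column that counts the left leaves before its subtree
  in the completed tree and the row that counts the right leaves after it. In a Baxter tableau,
  H forbids the columns of the left subtree of a point to pass the first column of its right
  subtree, and V forbids the rows of the right subtree to pass the first row of its left
  subtree. This forces the points to be exactly those of the above drawing of the underlying
  tree, and the drawing avoids H and V whatever the diagram is. So a Baxter tableau is a binary
  tree together with a Ferrers diagram of the right size that contains its drawing. The least such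
  diagram has the leaf word of the tree as its border, since a left leaf directly followed by
  a right leaf is its sibling; hence the diagrams are the paths weakly below the leaf
  word, that is, the first path does not meet the second. It remains that binary trees correspond to
  the pairs formed by the second and third path, because the traversal can be parsed
  deterministically from its edge letters and its leaf letters.\<close>

section \<open>Words and Ferrers diagrams\<close>

text \<open>The letters removed by \<open>Phi_P\<close> are always the same: the first leaf of the
  completed tree is a left leaf (East), the last a right leaf (North), and the border of a nonempty
  diagram starts with East and ends with North. So the full words can be restored without loss. A
  planar drawing gains a row with each left edge and a column with each right edge; hence all three
  words have \<open>right_edges\<close> East and \<open>left_edges\<close> North steps, which fixes
  endpoints and size. The starting points lie on one antidiagonal, so two paths can only meet after
  equally many steps, and disjointness becomes the weak prefix comparison \<open>below\<close>. For
  the third path the difficulty is an invariant of parsing that is both preserved and sufficient: it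
  compares edge prefixes with leaf prefixes shifted by the number of pending slots, and for a single
  slot it is \<open>below\<close> again. Parsing yields trees with \<open>unit\<close> labels,
  because the labels of \<open>binary_tree T\<close> are its cells; \<open>layout\<close> restores
  the cells.\<close>

abbreviation easts :: "step list \<Rightarrow> nat" where "easts w \<equiv> count_list w East"
abbreviation norths :: "step list \<Rightarrow> nat" where "norths w \<equiv> count_list w North"

lemma easts_plus_norths: "easts w + norths w = length w"
proof (induction w)
  case (Cons a w)
  then show ?case by (cases a) auto
qed simp

lemma easts_norths_take: "easts (take k w) + norths (take k w) = min (length w) k"
  using easts_plus_norths[of "take k w"] by simp

lemma count_take_plus_drop: "count_list (take k w) x + count_list (drop k w) x = count_list w x"
  by (metis append_take_drop_id count_list_append)

lemma count_take_mono: "j \<le> k \<Longrightarrow> count_list (take j w) x \<le> count_list (take k w) x"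
  by (metis count_list_append le_add1 le_add_diff_inverse take_add)

lemma count_drop_antimono: "j \<le> k \<Longrightarrow> count_list (drop k w) x \<le> count_list (drop j w) x"
  using count_take_mono[of j k w x] count_take_plus_drop[of j w x] count_take_plus_drop[of k w x]
  by linarith

lemma count_take_le: "count_list (take k w) x \<le> count_list w x"
  using count_take_plus_drop[of k w x] by linarith

text \<open>After \<open>k\<close> steps, paths from one starting point are on a common
  antidiagonal, so comparing East counts compares positions: \<open>u\<close> runs weakly south-east
  of \<open>v\<close>.\<close>

definition below :: "step list \<Rightarrow> step list \<Rightarrow> bool" where
  "below u v \<longleftrightarrow> (\<forall>k. easts (take k v) \<le> easts (take k u))"

lemma below_antisym:
  assumes "length u = length v" "below u v" "below v u"
  shows "u = v"
proof (rule nth_equalityI)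
  fix k assume k: "k < length u"
  have "easts (take (Suc k) u) = easts (take (Suc k) v)" "easts (take k u) = easts (take k v)"
    using assms by (simp_all add: below_def le_antisym)
  then have "u ! k = East \<longleftrightarrow> v ! k = East"
    using k assms(1) by (auto simp: take_Suc_conv_app_nth split: if_splits)
  then show "u ! k = v ! k" by (metis step.exhaust)
qed fact

text \<open>The cells north-west of a border \<open>w\<close> that runs from the bottom-left to the top-right corner; rows
  are thus counted from the end of \<open>w\<close>.\<close>

definition region :: "step list \<Rightarrow> cell set" where
  "region w = {(r, c). \<exists>k. c < easts (take k w) \<and> r < norths (drop k w)}"

text \<open>For words with equal counts, the East surplus of \<open>u\<close> in a prefix equals its
  North surplus in the remaining suffix, so one comparison controls both coordinates of a
  cell.\<close>

lemma region_subset_iff: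
  assumes len: "length u = length v" and eq: "easts u = easts v"
  shows "region v \<subseteq> region u \<longleftrightarrow> below u v"
proof
  have nn: "norths u = norths v"
    using len eq easts_plus_norths[of u] easts_plus_norths[of v] by linarith
  have dr: "norths (drop k v) + easts (take k u) = norths (drop k u) + easts (take k v)" for k
    using easts_norths_take[of k u] easts_norths_take[of k v] len nn
      count_take_plus_drop[of k u North] count_take_plus_drop[of k v North] by linarith
  show "below u v" if sub: "region v \<subseteq> region u"
    unfolding below_def
  proof (rule allI, rule ccontr)
    fix k assume "\<not> easts (take k v) \<le> easts (take k u)"
    then have less: "easts (take k u) < easts (take k v)" by simp
    then have less': "norths (drop k u) < norths (drop k v)" using dr[of k] by linarith
    \<comment> \<open>This cell has its bottom-right corner at the point that \<open>v\<close>
      reaches after \<open>k\<close> steps.\<close>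
    have "(norths (drop k v) - 1, easts (take k v) - 1) \<in> region v"
      using less less' unfolding region_def by (auto intro!: exI[of _ k])
    then obtain j where j: "easts (take k v) - 1 < easts (take j u)"
        "norths (drop k v) - 1 < norths (drop j u)"
      using sub unfolding region_def by auto
    then have "\<not> j \<le> k" "\<not> k \<le> j"
      using less less' count_take_mono[of j k u East] count_drop_antimono[of k j u North] by linarith+
    then show False by simp
  qed
  show "region v \<subseteq> region u" if b: "below u v"
  proof
    fix x assume "x \<in> region v"
    then obtain r c k where x: "x = (r, c)" "c < easts (take k v)" "r < norths (drop k v)"
      unfolding region_def by auto
    then have "c < easts (take k u)" "r < norths (drop k u)"
      using b[unfolded below_def, rule_format, of k] dr[of k] by linarith+
    then show "x \<in> region u" using x(1) unfolding region_def by auto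
  qed
qed

lemma region_inject:
  assumes "easts u = easts v" "norths u = norths v" "region u = region v"
  shows "u = v"
proof -
  have "length u = length v"
    using assms easts_plus_norths[of u] easts_plus_norths[of v] by linarith
  then show ?thesis
    using assms region_subset_iff[of u v] region_subset_iff[of v u] below_antisym by simp
qed

text \<open>\<open>u\<close> bounds the lower left part and \<open>v\<close> the upper right part.
  The region splits into that of \<open>u\<close>, shifted down by \<open>norths v\<close>, that of
  \<open>v\<close>, shifted right by \<open>easts u\<close>, and the full rectangle north-west of
  the junction.\<close>

lemma region_append:
  "(r, c) \<in> region (u @ v) \<longleftrightarrow>
     norths v \<le> r \<and> (r - norths v, c) \<in> region u \<or>
     easts u \<le> c \<and> (r, c - easts u) \<in> region v \<or>
     r < norths v \<and> c < easts u" (is "?L \<longleftrightarrow> ?R")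
proof
  assume ?L
  then obtain k where k: "c < easts (take k (u @ v))" "r < norths (drop k (u @ v))"
    unfolding region_def by auto
  show ?R
  proof (cases "k \<le> length u")
    case True
    then have "c < easts (take k u)" "r < norths (drop k u) + norths v" using k by auto
    moreover from this have "c < easts u" using count_take_le[of k u East] by linarith
    ultimately show ?thesis unfolding region_def
      by (cases "r < norths v") (auto intro!: exI[of _ k])
  next
    case False
    then have "c < easts u + easts (take (k - length u) v)" "r < norths (drop (k - length u) v)"
      using k by auto
    moreover from this have "r < norths v"
      using count_take_plus_drop[of "k - length u" v North] by linarith
    ultimately show ?thesis unfolding region_def
      by (cases "c < easts u") (auto intro!: exI[of _ "k - length u"])
  qed
next
  assume ?R
  then consider (1) "norths v \<le> r" "(r - norths v, c) \<in> region u"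
    | (2) "easts u \<le> c" "(r, c - easts u) \<in> region v"
    | (3) "r < norths v" "c < easts u" by blast
  then show ?L
  proof cases
    case 1
    then obtain k where k: "c < easts (take k u)" "r - norths v < norths (drop k u)"
      unfolding region_def by auto
    then have "k \<le> length u" by (cases "k \<le> length u") auto
    then show ?thesis using 1(1) k unfolding region_def by (auto intro!: exI[of _ k])
  next
    case 2
    then obtain k where "c - easts u < easts (take k v)" "r < norths (drop k v)"
      unfolding region_def by auto
    then show ?thesis using 2(1) unfolding region_def by (auto intro!: exI[of _ "k + length u"])
  next
    case 3
    then show ?thesis unfolding region_def by (auto intro!: exI[of _ "length u"])
  qed
qed

lemma region_single [simp]: "region [x] = {}"
  by (cases x) (auto simp: region_def take_Cons drop_Cons split: nat.splits)

lemma norths_drop_replicate_East [simp]: "norths (drop k (replicate m East)) = 0"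
  by (simp add: count_list_0_iff)

lemma region_replicate_East [simp]: "region (replicate m East) = {}"
  by (auto simp: region_def)

lemma count_list_replicate_same [simp]: "count_list (replicate m x) x = m"
  by (induction m) auto

lemma count_list_replicate_diff [simp]: "x \<noteq> y \<Longrightarrow> count_list (replicate m x) y = 0"
  by (induction m) auto

section \<open>Row lengths and borders of Ferrers diagrams\<close>

lemma initial_segment_eq:
  fixes A :: "nat set"
  assumes "finite A" "\<And>x y. x \<in> A \<Longrightarrow> y \<le> x \<Longrightarrow> y \<in> A"
  shows "A = {..<card A}"
proof -
  have "{..x} \<subseteq> A" if "x \<in> A" for x using assms(2)[OF that] by auto
  then have "x < card A" if "x \<in> A" for x
    using card_mono[OF assms(1), of "{..x}"] that by fastforce
  then have "A \<subseteq> {..<card A}" by auto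
  then show ?thesis by (simp add: card_subset_eq)
qed

lemma ferrers_mem: "ferrers D \<Longrightarrow> (r, c) \<in> D \<Longrightarrow> r' \<le> r \<Longrightarrow> c' \<le> c \<Longrightarrow> (r', c') \<in> D"
  unfolding ferrers_def by blast

lemma ferrers_row_eq:
  assumes "ferrers D" shows "{c. (r, c) \<in> D} = {..<row_length D r}"
  unfolding row_length_def
proof (rule initial_segment_eq)
  have "{c. (r, c) \<in> D} \<subseteq> snd ` D" by force
  then show "finite {c. (r, c) \<in> D}" using assms by (auto simp: ferrers_def intro: finite_subset)
qed (use assms ferrers_mem in auto)

lemma ferrers_mem_iff_row_length: "ferrers D \<Longrightarrow> (r, c) \<in> D \<longleftrightarrow> c < row_length D r"
  using ferrers_row_eq[of D r] by auto

lemma ferrers_fst_image: assumes "ferrers D" shows "fst ` D = {..<num_rows D}"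
  unfolding num_rows_def
proof (rule initial_segment_eq)
  show "finite (fst ` D)" using assms by (simp add: ferrers_def)
  show "y \<in> fst ` D" if "x \<in> fst ` D" "y \<le> x" for x y
    using that ferrers_mem[OF assms] by force
qed

lemma ferrers_snd_image: assumes "ferrers D" shows "snd ` D = {..<row_length D 0}"
proof -
  have "snd ` D = {c. (0, c) \<in> D}"
    using ferrers_mem[OF assms] by (force simp: image_iff)
  then show ?thesis using ferrers_row_eq[OF assms] by simp
qed

lemma row_length_antimono: "ferrers D \<Longrightarrow> r \<le> s \<Longrightarrow> row_length D s \<le> row_length D r"
  by (metis ferrers_mem ferrers_mem_iff_row_length linorder_not_le order_refl)

lemma row_length_pos_iff: "ferrers D \<Longrightarrow> 0 < row_length D r \<longleftrightarrow> r < num_rows D"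
proof -
  assume f: "ferrers D"
  have "r < num_rows D \<longleftrightarrow> r \<in> fst ` D" using ferrers_fst_image[OF f] by simp
  also have "\<dots> \<longleftrightarrow> (r, 0) \<in> D" using ferrers_mem[OF f] by (force simp: image_iff)
  finally show ?thesis using ferrers_mem_iff_row_length[OF f] by simp
qed

text \<open>The word of the top \<open>m\<close> rows starts at column \<open>l m\<close>, so only
  columns from \<open>l m\<close> on are seen. The induction prepends row \<open>m\<close>; the
  subtraction disappears once \<open>l m = 0\<close>.\<close>

lemma region_rows:
  fixes l :: "nat \<Rightarrow> nat"
  assumes "\<And>r s. r \<le> s \<Longrightarrow> l s \<le> l r"
  defines "w \<equiv> \<lambda>m. concat (map (\<lambda>r. replicate (l r - l (Suc r)) East @ [North]) (rev [0..<m]))"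
  shows "norths (w m) = m" "easts (w m) = l 0 - l m" "region (w m) = {(r, c). r < m \<and> c < l r - l m}"
proof (induction m)
  case 0
  show "norths (w 0) = 0" "easts (w 0) = l 0 - l 0" "region (w 0) = {(r, c). r < 0 \<and> c < l r - l 0}"
    by (simp_all add: w_def region_def)
next
  case (Suc m)
  have w: "w (Suc m) = replicate (l m - l (Suc m)) East @ [North] @ w m" by (simp add: w_def)
  have l: "l (Suc m) \<le> l m" "l m \<le> l 0" using assms(1) by auto
  show "norths (w (Suc m)) = Suc m" using w Suc by simp
  show "easts (w (Suc m)) = l 0 - l (Suc m)" using w Suc l by simp
  have lr: "l m \<le> l r" if "r < m" for r using assms(1) that by simp
  have "(r, c) \<in> region (w (Suc m)) \<longleftrightarrow> r < Suc m \<and> c < l r - l (Suc m)" for r c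
    unfolding w region_append using Suc l lr[of r]
    by (auto simp: region_append less_Suc_eq)
  then show "region (w (Suc m)) = {(r, c). r < Suc m \<and> c < l r - l (Suc m)}" by auto
qed

lemma se_border_counts:
  assumes "ferrers D"
  shows "norths (se_border D) = num_rows D" "easts (se_border D) = row_length D 0"
    and region_se_border: "region (se_border D) = D"
proof -
  have 0: "row_length D (num_rows D) = 0" using row_length_pos_iff[OF assms] by blast
  note * = region_rows[of "row_length D" "num_rows D", OF row_length_antimono[OF assms],
      folded se_border_def, unfolded 0]
  show "norths (se_border D) = num_rows D" "easts (se_border D) = row_length D 0" using * by auto
  have "r < num_rows D \<and> c < row_length D r \<longleftrightarrow> (r, c) \<in> D" for r c
    using ferrers_mem_iff_row_length[OF assms] row_length_pos_iff[OF assms, of r] by force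
  then show "region (se_border D) = D" using *(3) by auto
qed

text \<open>The lowest row is nonempty and has no cell under it, so its block starts with East; the
  block of row 0 ends with North.\<close>

lemma se_border_shape:
  assumes "ferrers D" "D \<noteq> {}"
  shows "se_border D = East # butlast (tl (se_border D)) @ [North]"
proof -
  obtain r0 c0 where "(r0, c0) \<in> D" using assms(2) by auto
  then have "(0, 0) \<in> D" using ferrers_mem[OF assms(1)] by blast
  then have "0 < num_rows D"
    using ferrers_mem_iff_row_length[OF assms(1)] row_length_pos_iff[OF assms(1)] by simp
  then obtain m where m: "num_rows D = Suc m" using not0_implies_Suc by blast
  have "row_length D m > 0" "row_length D (Suc m) = 0"
    using row_length_pos_iff[OF assms(1)] m by auto
  then obtain k where k: "row_length D m - row_length D (Suc m) = Suc k"
    using gr0_implies_Suc by force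
  let ?f = "\<lambda>r. replicate (row_length D r - row_length D (Suc r)) East @ [North]"
  have b: "se_border D = concat (map ?f (rev [0..<Suc m]))" by (simp add: se_border_def m)
  then have "\<exists>u. se_border D = East # u" using k by simp
  then obtain u where u: "se_border D = East # u" by blast
  have "se_border D = concat (map ?f (rev [Suc 0..<Suc m])) @ ?f 0"
    unfolding b by (subst upt_conv_Cons) simp_all
  then obtain v where v: "se_border D = v @ [North]" by simp
  show ?thesis using u v by (cases u rule: rev_cases) auto
qed

text \<open>The outer steps rule out empty rows and columns: after the initial East, column 0 meets
  all rows, and before the final North, row 0 meets all columns.\<close>

lemma region_border:
  assumes "w = East # u @ [North]"
  shows "ferrers (region w)" "fst ` region w = {..<norths w}" "snd ` region w = {..<easts w}"
proof -
  have *: "r < norths w \<and> c < easts w" if rc: "(r, c) \<in> region w" for r c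
  proof -
    obtain k where "c < easts (take k w)" "r < norths (drop k w)"
      using rc unfolding region_def by auto
    then show ?thesis
      using count_take_plus_drop[of k w North] count_take_le[of k w East] by linarith
  qed
  then have "region w \<subseteq> {..<norths w} \<times> {..<easts w}" by auto
  then have "finite (region w)" by (rule finite_subset) simp
  then show "ferrers (region w)"
    unfolding ferrers_def by (auto simp: region_def) (meson le_less_trans)
  have "(r, 0) \<in> region w" if "r < norths w" for r
    using that assms unfolding region_def by (auto intro!: exI[of _ 1])
  then show "fst ` region w = {..<norths w}" using * by force
  have "(0, c) \<in> region w" if "c < easts w" for c
    using that assms unfolding region_def by (auto intro!: exI[of _ "Suc (length u)"])
  then show "snd ` region w = {..<easts w}" using * by force
qed

lemma se_border_region:
  assumes "w = East # u @ [North]"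
  shows "se_border (region w) = w"
proof (rule region_inject)
  note R = region_border[OF assms]
  show "norths (se_border (region w)) = norths w"
    using R se_border_counts(1)[OF R(1)] by (simp add: num_rows_def)
  show "easts (se_border (region w)) = easts w"
    using R se_border_counts(2)[OF R(1)] ferrers_snd_image[OF R(1)] by simp
  show "region (se_border (region w)) = region w" using R(1) by (rule region_se_border)
qed

section \<open>Words of binary trees\<close>

text \<open>A left or right slot is the place of a possible left or right child. The words of a subtree
  in a slot include the letter by which the traversal enters that slot, and nothing is deleted
  from the leaf letters.\<close>

fun left_slot_edges :: "'a tree \<Rightarrow> step list" and right_slot_edges :: "'a tree \<Rightarrow> step list" where
  "left_slot_edges Leaf = []"
| "left_slot_edges (Node l _ r) = North # left_slot_edges l @ right_slot_edges r"
| "right_slot_edges Leaf = []"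
| "right_slot_edges (Node l _ r) = East # left_slot_edges l @ right_slot_edges r"

fun left_slot_leaves :: "'a tree \<Rightarrow> step list" and right_slot_leaves :: "'a tree \<Rightarrow> step list" where
  "left_slot_leaves Leaf = [East]"
| "left_slot_leaves (Node l _ r) = left_slot_leaves l @ right_slot_leaves r"
| "right_slot_leaves Leaf = [North]"
| "right_slot_leaves (Node l _ r) = left_slot_leaves l @ right_slot_leaves r"

abbreviation edge_step :: "letter \<Rightarrow> step" where
  "edge_step x \<equiv> if x = E_left then North else East"

abbreviation leaf_step :: "letter \<Rightarrow> step" where
  "leaf_step x \<equiv> if x = L_left then East else North"

lemma edges_traversal:
  "left_slot_edges t = map edge_step (filter (\<lambda>x. \<not> is_leaf_letter x)
     (if t = Leaf then [L_left] else E_left # traversal t))" (is ?A)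
  "right_slot_edges t = map edge_step (filter (\<lambda>x. \<not> is_leaf_letter x)
     (if t = Leaf then [L_right] else E_right # traversal t))" (is ?B)
proof -
  have "?A \<and> ?B" by (induction t) (auto simp: is_leaf_letter_def)
  then show ?A ?B by auto
qed

lemma leaves_traversal:
  "left_slot_leaves t = map leaf_step (filter is_leaf_letter
     (if t = Leaf then [L_left] else E_left # traversal t))" (is ?A)
  "right_slot_leaves t = map leaf_step (filter is_leaf_letter
     (if t = Leaf then [L_right] else E_right # traversal t))" (is ?B)
proof -
  have "?A \<and> ?B" by (induction t) (auto simp: is_leaf_letter_def)
  then show ?A ?B by auto
qed

text \<open>Deletion in the mixed word thereby becomes \<open>tl\<close> (and, reversed,
  \<open>butlast\<close>) on the leaf letters and leaves the edge letters alone.\<close>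

lemma filter_delete_first:
  "filter P (delete_first P xs) = tl (filter P xs)"
  "filter (\<lambda>x. \<not> P x) (delete_first P xs) = filter (\<lambda>x. \<not> P x) xs"
proof -
  have "filter P (delete_first P xs) = tl (filter P xs) \<and>
    filter (\<lambda>x. \<not> P x) (delete_first P xs) = filter (\<lambda>x. \<not> P x) xs"
    unfolding delete_first_def by (induction xs) auto
  then show "filter P (delete_first P xs) = tl (filter P xs)"
    "filter (\<lambda>x. \<not> P x) (delete_first P xs) = filter (\<lambda>x. \<not> P x) xs" by auto
qed

lemma filter_delete_last:
  "filter P (delete_last P xs) = butlast (filter P xs)"
  "filter (\<lambda>x. \<not> P x) (delete_last P xs) = filter (\<lambda>x. \<not> P x) xs"
  using filter_delete_first[of P "rev xs"]
  by (simp_all add: delete_last_def flip: rev_filter butlast_rev)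

lemma word1_Node: "word1 (Node l x r) = left_slot_edges l @ right_slot_edges r"
  unfolding word1_def word_def filter_delete_last filter_delete_first edges_traversal by simp

lemma word2_Node: "word2 (Node l x r) = butlast (tl (left_slot_leaves l @ right_slot_leaves r))"
  unfolding word2_def word_def filter_delete_last filter_delete_first leaves_traversal
  by (simp add: map_butlast map_tl)

lemma left_slot_leaves_hd: "\<exists>u. left_slot_leaves t = East # u"
  by (induction t) auto

lemma right_slot_leaves_last: "\<exists>u. right_slot_leaves t = u @ [North]"
proof (induction t)
  case (Node l x r)
  then obtain u where "right_slot_leaves r = u @ [North]" by blast
  then show ?case by simp
qed simp

text \<open>The traversal can be recovered from the two words one letter at a time: an edge to a left child
  comes next iff a left slot is due and the edge word continues with North, and an edge to a
  right child comes next iff a right slot is due and the leaf word continues with East. The two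
  predicates describe the unread words \<open>e\<close>, \<open>f\<close> when \<open>k\<close> right slots are pending, in the second
  case behind one left slot.\<close>

definition right_state :: "nat \<Rightarrow> step list \<Rightarrow> step list \<Rightarrow> bool" where
  "right_state k e f \<longleftrightarrow> (e = [] \<or> hd e = East) \<and> easts f = easts e \<and> length f = length e + k \<and>
     (\<forall>j < length e. easts (take (Suc j) e) \<le> easts (take (j + k) f))"

definition left_state :: "nat \<Rightarrow> step list \<Rightarrow> step list \<Rightarrow> bool" where
  "left_state k e f \<longleftrightarrow> k > 0 \<and> f \<noteq> [] \<and> hd f = East \<and> easts f = Suc (easts e) \<and>
     length f = Suc (length e + k) \<and>
     (\<forall>j \<le> length e. Suc (easts (take j e)) \<le> easts (take (j + k) f))"

text \<open>If \<open>e\<close> started with East, the condition at \<open>j = 0\<close> would ask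
  for an East in the empty prefix of \<open>f\<close>.\<close>

lemma right_state_0: "right_state 0 e f \<longleftrightarrow> e = [] \<and> f = []"
proof
  assume s: "right_state 0 e f"
  have "e = []"
  proof (rule ccontr)
    assume "e \<noteq> []"
    then obtain e' where "e = East # e'" using s by (cases e) (auto simp: right_state_def)
    then show False using s by (auto simp: right_state_def dest: spec[of _ 0])
  qed
  then show "e = [] \<and> f = []" using s by (auto simp: right_state_def)
qed (simp add: right_state_def)

lemma right_state_North: "right_state (Suc k) e (North # f) \<longleftrightarrow> right_state k e f"
  by (auto simp: right_state_def)

text \<open>The East of \<open>f\<close> is only looked at: it belongs to the leftmost leaf below
  the new vertex. The edge letter is consumed, and the right slot of the new vertex replaces the one
  just filled, so \<open>k\<close> stays.\<close>

lemma right_state_East: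
  "right_state k e (East # f) \<longleftrightarrow> k > 0 \<and> (\<exists>e'. e = East # e' \<and> left_state k e' (East # f))"
proof (cases e)
  case Nil
  then show ?thesis by (auto simp: right_state_def)
next
  case (Cons a e')
  show ?thesis
    by (cases a; cases k)
       (auto simp: Cons right_state_def left_state_def less_Suc_eq_le dest: spec[of _ 0])
qed

lemma all_le_Suc_iff: "(\<forall>j \<le> Suc n. P j) \<longleftrightarrow> P 0 \<and> (\<forall>j \<le> n. P (Suc j))"
  by (metis Suc_le_mono le0 not0_implies_Suc)

text \<open>Entering a left child opens its right slot as well, whence \<open>Suc k\<close>.\<close>

lemma left_state_North:
  assumes "k > 0" shows "left_state k (North # e) f \<longleftrightarrow> left_state (Suc k) e f"
proof -
  \<comment> \<open>The prefix \<open>j = 0\<close> on the left is the only one without a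
    counterpart on the right.\<close>
  have "1 \<le> easts (take k f)" if "f \<noteq> []" "hd f = East"
    using that assms by (cases f; cases k) auto
  then show ?thesis using assms by (auto simp: left_state_def all_le_Suc_iff)
qed

lemma left_state_East:
  assumes "e = [] \<or> hd e = East" "k > 0"
  shows "left_state k e (East # f) \<longleftrightarrow> right_state k e f"
proof -
  obtain m where m: "k = Suc m" using assms(2) gr0_implies_Suc by blast
  show ?thesis
  proof (cases e)
    case Nil
    then show ?thesis by (auto simp: m left_state_def right_state_def)
  next
    case (Cons a e')
    then show ?thesis using assms(1)
      by (auto simp: m left_state_def right_state_def all_le_Suc_iff less_Suc_eq_le)
  qed
qed

section \<open>Parsing pairs of words into forests\<close>

abbreviation forest_edges :: "'a tree list \<Rightarrow> step list" where
  "forest_edges ts \<equiv> concat (map right_slot_edges ts)"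

abbreviation forest_leaves :: "'a tree list \<Rightarrow> step list" where
  "forest_leaves ts \<equiv> concat (map right_slot_leaves ts)"

text \<open>The transitions are read backwards: the right subtree is put in front of the pending
  slots, then the left subtree, then the letter of the entering edge.\<close>

lemma slot_states:
  "right_state k e f \<Longrightarrow> k > 0 \<Longrightarrow> left_state k (left_slot_edges t @ e) (left_slot_leaves t @ f)"
  "right_state k e f \<Longrightarrow> right_state (Suc k) (right_slot_edges t @ e) (right_slot_leaves t @ f)"
proof (induction t arbitrary: k e f)
  case Leaf
  {
    case 1
    then show ?case by (simp add: left_state_East right_state_def)
  next
    case 2
    then show ?case by (simp add: right_state_North)
  }
next
  case (Node l x r)
  {
    fix k e f assume "right_state k e f"
    then have "left_state (Suc k) (left_slot_edges l @ right_slot_edges r @ e)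
        (left_slot_leaves l @ right_slot_leaves r @ f)"
      using Node.IH(1,4) by blast
  } note * = this
  {
    case 1
    then show ?case using * by (simp add: left_state_North)
  next
    case 2
    obtain u where "left_slot_leaves l = East # u" using left_slot_leaves_hd by blast
    then show ?case using *[OF 2] by (simp add: right_state_East)
  }
qed

lemma forest_edges_hd: "forest_edges ts = [] \<or> hd (forest_edges ts) = East"
proof (induction ts)
  case (Cons t ts)
  then show ?case by (cases t) auto
qed simp

text \<open>The converse of \<open>slot_states\<close>: an invariant state with unread letters
  always permits a transition, and each transition consumes a letter.\<close>

lemma parse_exists:
  "right_state k e f \<Longrightarrow>
     \<exists>ts :: unit tree list. length ts = k \<and> forest_edges ts = e \<and> forest_leaves ts = f"
  "left_state k e f \<Longrightarrow> \<exists>(t :: unit tree) (ts :: unit tree list). length ts = k \<and>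
     left_slot_edges t @ forest_edges ts = e \<and> left_slot_leaves t @ forest_leaves ts = f"
proof (induction "length e + length f" arbitrary: k e f rule: less_induct)
  case less
  {
    case 1
    show ?case
    proof (cases f)
      case Nil
      then show ?thesis using 1 by (auto simp: right_state_def)
    next
      case f: (Cons a f')
      show ?thesis
      proof (cases a)
        case North
        have "k \<noteq> 0" using 1 f right_state_0 by (metis list.distinct(1))
        then obtain m where k: "k = Suc m" using not0_implies_Suc by blast
        have "right_state m e f'" using 1 unfolding f North k right_state_North .
        then obtain ts :: "unit tree list" where
          "length ts = m \<and> forest_edges ts = e \<and> forest_leaves ts = f'"
          using less(1)[of e f' m] f by auto
        then show ?thesis by (intro exI[of _ "Leaf # ts"]) (simp add: f North k)
      next
        case East
        then obtain e' where e: "e = East # e'" "left_state k e' f" "k > 0"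
          using 1 unfolding f East right_state_East by blast
        have "\<exists>(t :: unit tree) (ts :: unit tree list). length ts = k \<and>
            left_slot_edges t @ forest_edges ts = e' \<and> left_slot_leaves t @ forest_leaves ts = f"
          by (rule less(2)) (use e in auto)
        then obtain t :: "unit tree" and ts :: "unit tree list" where *: "length ts = k"
          "left_slot_edges t @ forest_edges ts = e'" "left_slot_leaves t @ forest_leaves ts = f"
          by blast
        \<comment> \<open>\<open>r\<close> fills the right slot of the new vertex, whose left
          subtree is \<open>t\<close>.\<close>
        obtain r us where "ts = r # us" using *(1) e(3) by (cases ts) auto
        then show ?thesis using * e by (intro exI[of _ "Node t () r # us"]) auto
      qed
    qed
  next
    case 2
    then have k: "k > 0" by (simp add: left_state_def)
    show ?case
    proof (cases "e = [] \<or> hd e = East")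
      case True
      obtain f' where f: "f = East # f'" using 2 by (cases f) (auto simp: left_state_def)
      then have "right_state k e f'" using 2 True k left_state_East by blast
      then obtain ts :: "unit tree list" where
        "length ts = k \<and> forest_edges ts = e \<and> forest_leaves ts = f'"
        using less(1)[of e f' k] f by auto
      then show ?thesis by (intro exI[of _ Leaf] exI[of _ ts]) (simp add: f)
    next
      case False
      then obtain e' where e: "e = North # e'" by (cases e) (auto, metis step.exhaust)
      then have "left_state (Suc k) e' f" using 2 k left_state_North by blast
      then have "\<exists>(t :: unit tree) (ts :: unit tree list). length ts = Suc k \<and>
          left_slot_edges t @ forest_edges ts = e' \<and> left_slot_leaves t @ forest_leaves ts = f"
        by (intro less(2)) (simp_all add: e)
      then obtain t :: "unit tree" and ts :: "unit tree list" where *: "length ts = Suc k"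
        "left_slot_edges t @ forest_edges ts = e'" "left_slot_leaves t @ forest_leaves ts = f"
        by blast
      obtain r us where "ts = r # us" using *(1) by (cases ts) auto
      then show ?thesis using * e
        by (intro exI[of _ "Node t () r"] exI[of _ us]) auto
    qed
  }
qed

text \<open>A nonempty subtree lists its leftmost leaf first, which is a left leaf, so one letter of
  the leaf word decides.\<close>

lemma right_slot_leaves_Leaf_iff:
  assumes "right_slot_leaves t @ g = f" shows "t = Leaf \<longleftrightarrow> hd f = North"
proof (cases t)
  case (Node l x r)
  obtain u where "left_slot_leaves l = East # u" using left_slot_leaves_hd by blast
  then show ?thesis using assms Node by auto
qed (use assms in auto)

text \<open>Only right slots follow, and their edge words can only start with East, so an initial
  North must come from \<open>t\<close>.\<close>

lemma left_slot_edges_Leaf_iff: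
  assumes "left_slot_edges t @ forest_edges ts = e"
  shows "t = Leaf \<longleftrightarrow> e = [] \<or> hd e = East"
  using assms forest_edges_hd[of ts] by (cases t) auto

text \<open>Both parses take the same branch, dictated by the first letters of \<open>e\<close> and
  \<open>f\<close>; removing the letter read leaves a shorter instance.\<close>

lemma parse_unique:
  fixes ts us :: "unit tree list" and t u :: "unit tree"
  shows
  "length ts = length us \<Longrightarrow> forest_edges ts = e \<Longrightarrow> forest_edges us = e \<Longrightarrow>
     forest_leaves ts = f \<Longrightarrow> forest_leaves us = f \<Longrightarrow> ts = us"
  "length ts = length us \<Longrightarrow>
     left_slot_edges t @ forest_edges ts = e \<Longrightarrow> left_slot_edges u @ forest_edges us = e \<Longrightarrow>
     left_slot_leaves t @ forest_leaves ts = f \<Longrightarrow> left_slot_leaves u @ forest_leaves us = f \<Longrightarrow>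
     t = u \<and> ts = us"
proof (induction "length e + length f" arbitrary: e f t u ts us rule: less_induct)
  case less
  {
    case 1
    show ?case
    proof (cases ts)
      case Nil
      then show ?thesis using 1(1) by simp
    next
      case ts: (Cons t ts')
      then obtain u us' where us: "us = u # us'" using 1(1) by (cases us) auto
      have len: "length ts' = length us'" using 1(1) ts us by simp
      have e: "right_slot_edges t @ forest_edges ts' = e" "right_slot_edges u @ forest_edges us' = e"
        using 1(2,3) by (simp_all add: ts us)
      have f: "right_slot_leaves t @ forest_leaves ts' = f" "right_slot_leaves u @ forest_leaves us' = f"
        using 1(4,5) by (simp_all add: ts us)
      show ?thesis
      proof (cases "hd f = North")
        case True
        then have tu: "t = Leaf" "u = Leaf"
          using right_slot_leaves_Leaf_iff[of t] right_slot_leaves_Leaf_iff[of u] f by blast+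
        have "ts' = us'"
          by (rule less(1)[of e "tl f"]) (use e f tu len in \<open>simp_all, auto\<close>)
        then show ?thesis using ts us tu by simp
      next
        case False
        then have "t \<noteq> Leaf" "u \<noteq> Leaf"
          using right_slot_leaves_Leaf_iff[of t] right_slot_leaves_Leaf_iff[of u] f by blast+
        then obtain l r l' r' where tu: "t = Node l () r" "u = Node l' () r'"
          by (cases t; cases u) auto
        have "l = l' \<and> r # ts' = r' # us'"
        proof (rule less(2)[of "tl e" f])
          show "length (tl e) + length f < length e + length f" using e(1) tu(1) by auto
        qed (use e[THEN arg_cong[of _ _ tl]] f tu len in simp_all)
        then show ?thesis using ts us tu by simp
      qed
    qed
  next
    case 2
    show ?case
    proof (cases "e = [] \<or> hd e = East")
      case True
      then have tu: "t = Leaf" "u = Leaf"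
        using left_slot_edges_Leaf_iff[of t] left_slot_edges_Leaf_iff[of u] 2(2,3) by blast+
      have "ts = us"
        by (rule less(1)[of e "tl f"]) (use 2 tu in \<open>simp_all, auto\<close>)
      then show ?thesis using tu by simp
    next
      case False
      then have "t \<noteq> Leaf" "u \<noteq> Leaf"
        using left_slot_edges_Leaf_iff[of t] left_slot_edges_Leaf_iff[of u] 2(2,3) by blast+
      then obtain l r l' r' where tu: "t = Node l () r" "u = Node l' () r'"
        by (cases t; cases u) auto
      have "l = l' \<and> r # ts = r' # us"
      proof (rule less(2)[of "tl e" f])
        show "length (tl e) + length f < length e + length f" using 2(2) tu(1) by auto
      qed (use 2(1,4,5) 2(2,3)[THEN arg_cong[of _ _ tl]] tu in simp_all)
      then show ?thesis using tu by simp
    qed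
  }
qed

section \<open>Pairs of words that encode binary trees\<close>

lemma right_slot_leaves_eq: "t \<noteq> Leaf \<Longrightarrow> right_slot_leaves t = East # word2 t @ [North]"
proof (cases t)
  case (Node l x r)
  obtain u v where "left_slot_leaves l = East # u" "right_slot_leaves r = v @ [North]"
    using left_slot_leaves_hd right_slot_leaves_last by blast
  then show ?thesis by (simp add: Node  word2_Node butlast_append)
qed simp

lemma right_slot_edges_eq: "t \<noteq> Leaf \<Longrightarrow> right_slot_edges t = East # word1 t"
  by (cases t) (simp_all add: word1_Node)

text \<open>The leading East letters cancel and the single pending slot aligns the prefixes, so the
  parsing invariant is the comparison of the second with the third path.\<close>

lemma right_state_1:
  "right_state 1 (East # u) (East # v @ [North]) \<longleftrightarrow>
     easts u = easts v \<and> length u = length v \<and> below v u"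
proof -
  have "(\<forall>j \<le> length u. easts (take j u) \<le> easts (take j (v @ [North]))) \<longleftrightarrow> below v u"
    if len: "length u = length v"
  proof -
    have "easts (take j u) \<le> easts (take j v)" if
      "\<forall>j \<le> length u. easts (take j u) \<le> easts (take j (v @ [North]))" for j
      using that[rule_format, of "min j (length u)"] len by (cases "j \<le> length u") auto
    then show ?thesis using len by (auto simp: below_def)
  qed
  then show ?thesis by (auto simp: right_state_def less_Suc_eq_le)
qed

lemma words_below:
  assumes "t \<noteq> Leaf"
  shows "easts (word1 t) = easts (word2 t)" "length (word1 t) = length (word2 t)"
    "below (word2 t) (word1 t)"
proof -
  have "right_state 1 (right_slot_edges t) (right_slot_leaves t)"
    using slot_states(2)[of 0 "[]" "[]" t] by (simp add: right_state_0)
  then have "right_state 1 (East # word1 t) (East # word2 t @ [North])"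
    using right_slot_leaves_eq[OF assms] right_slot_edges_eq[OF assms] by simp
  then show "easts (word1 t) = easts (word2 t)" "length (word1 t) = length (word2 t)"
    "below (word2 t) (word1 t)"
    unfolding right_state_1 by auto
qed

lemma words_surj:
  assumes "easts u = easts v" "length u = length v" "below v u"
  obtains t :: "unit tree" where "t \<noteq> Leaf" "word1 t = u" "word2 t = v"
proof -
  have "right_state 1 (East # u) (East # v @ [North])" using assms right_state_1 by blast
  then obtain ts :: "unit tree list" where ts: "length ts = 1" "forest_edges ts = East # u"
    "forest_leaves ts = East # v @ [North]" using parse_exists(1) by blast
  then obtain t where "ts = [t]" by (auto simp: length_Suc_conv)
  then have t: "right_slot_edges t = East # u" "right_slot_leaves t = East # v @ [North]"
    using ts by auto
  then have "t \<noteq> Leaf" by auto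
  then show ?thesis using that[of t] t right_slot_leaves_eq[of t] right_slot_edges_eq[of t]
    by (auto simp: )
qed

lemma words_inject:
  fixes t u :: "unit tree"
  assumes "t \<noteq> Leaf" "u \<noteq> Leaf" "word1 t = word1 u" "word2 t = word2 u"
  shows "t = u"
proof -
  have "right_slot_edges t = right_slot_edges u" "right_slot_leaves t = right_slot_leaves u"
    using assms right_slot_leaves_eq[of t] right_slot_leaves_eq[of u]
    by (auto simp: right_slot_edges_eq )
  then have "[t] = [u]" by (intro parse_unique(1)) auto
  then show ?thesis by simp
qed

lemma slot_words_map_tree [simp]:
  "left_slot_edges (map_tree g t) = left_slot_edges t"
  "right_slot_edges (map_tree g t) = right_slot_edges t"
  "left_slot_leaves (map_tree g t) = left_slot_leaves t"
  "right_slot_leaves (map_tree g t) = right_slot_leaves t"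
  by (induction t) auto

lemma words_map_tree [simp]:
  "word1 (map_tree g t) = word1 t" "word2 (map_tree g t) = word2 t"
  by (cases t; simp add: word1_Node word2_Node; simp add: word1_def word2_def word_def)+

section \<open>Planar drawings of binary trees\<close>

text \<open>In a planar drawing every left edge opens a new row and every right edge a new
  column.\<close>

fun left_edges :: "'a tree \<Rightarrow> nat" and right_edges :: "'a tree \<Rightarrow> nat" where
  "left_edges Leaf = 0"
| "left_edges (Node l _ r) = (if l = Leaf then 0 else Suc (left_edges l)) + left_edges r"
| "right_edges Leaf = 0"
| "right_edges (Node l _ r) = right_edges l + (if r = Leaf then 0 else Suc (right_edges r))"

lemma left_plus_right_edges: "t \<noteq> Leaf \<Longrightarrow> Suc (left_edges t + right_edges t) = size t"
  by (induction t) auto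

text \<open>In a Baxter tableau the left subtree of a point lies strictly below and left of its right
  subtree.\<close>

fun planar :: "cell tree \<Rightarrow> bool" where
  "planar Leaf = True"
| "planar (Node l p r) \<longleftrightarrow> planar l \<and> planar r \<and>
     (\<forall>x \<in> set_tree l. fst p < fst x \<and> snd p \<le> snd x) \<and>
     (\<forall>y \<in> set_tree r. fst p \<le> fst y \<and> snd p < snd y) \<and>
     (\<forall>x \<in> set_tree l. \<forall>y \<in> set_tree r. fst y < fst x \<and> snd x < snd y) \<and>
     (l \<noteq> Leaf \<longrightarrow> snd (value l) = snd p) \<and> (r \<noteq> Leaf \<longrightarrow> fst (value r) = fst p)"

text \<open>The column of a vertex counts the left leaves before its subtree, its row the right leaves
  after it; \<open>c\<close> and \<open>r\<close> are these numbers for the root.\<close>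

fun layout :: "nat \<Rightarrow> nat \<Rightarrow> 'a tree \<Rightarrow> cell tree" where
  "layout r c Leaf = Leaf"
| "layout r c (Node a x b) =
     Node (layout (r + Suc (left_edges b)) c a) (r, c) (layout r (c + Suc (right_edges a)) b)"

lemma layout_eq_Leaf_iff [simp]: "layout r c t = Leaf \<longleftrightarrow> t = Leaf"
  by (cases t) auto

lemma value_layout [simp]: "t \<noteq> Leaf \<Longrightarrow> value (layout r c t) = (r, c)"
  by (cases t) auto

lemma value_in_set_tree [simp]: "t \<noteq> Leaf \<Longrightarrow> value t \<in> set_tree t"
  by (cases t) auto

lemma left_edges_map_tree [simp]: "left_edges (map_tree f t) = left_edges t"
  and right_edges_map_tree [simp]: "right_edges (map_tree f t) = right_edges t"
  by (induction t) auto

lemma layout_map_tree [simp]: "layout r c (map_tree f t) = layout r c t"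
  by (induction t arbitrary: r c) auto

lemma map_tree_layout: "map_tree (\<lambda>_. ()) (layout r c t) = map_tree (\<lambda>_. ()) t"
  by (induction t arbitrary: r c) auto

lemma rows_layout: "t \<noteq> Leaf \<Longrightarrow> fst ` set_tree (layout r c t) = {r..r + left_edges t}"
proof (induction t arbitrary: r c)
  case (Node a x b)
  then show ?case by (cases "a = Leaf"; cases "b = Leaf") (auto simp: image_Un)
qed simp

lemma columns_layout: "t \<noteq> Leaf \<Longrightarrow> snd ` set_tree (layout r c t) = {c..c + right_edges t}"
proof (induction t arbitrary: r c)
  case (Node a x b)
  then show ?case by (cases "a = Leaf"; cases "b = Leaf") (auto simp: image_Un)
qed simp

lemma layout_bounds:
  assumes "p \<in> set_tree (layout r c t)"
  shows "r \<le> fst p" "fst p \<le> r + left_edges t" "c \<le> snd p" "snd p \<le> c + right_edges t"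
proof -
  have t: "t \<noteq> Leaf" using assms by auto
  have "fst p \<in> {r..r + left_edges t}" "snd p \<in> {c..c + right_edges t}"
    using assms rows_layout[OF t, of r c] columns_layout[OF t, of r c] by blast+
  then show "r \<le> fst p" "fst p \<le> r + left_edges t" "c \<le> snd p" "snd p \<le> c + right_edges t"
    by auto
qed

lemma planar_layout: "planar (layout r c t)"
proof (induction t arbitrary: r c)
  case (Node a x b)
  then show ?case
    using layout_bounds[where t = a and r = "r + Suc (left_edges b)" and c = c]
      layout_bounds[where t = b and r = r and c = "c + Suc (right_edges a)"]
    by (fastforce simp del: add_Suc_right)
qed simp

lemma planar_root_le:
  assumes "planar t" "x \<in> set_tree t"
  shows "fst (value t) \<le> fst x" "snd (value t) \<le> snd x"
  using assms by (cases t; force simp: less_imp_le)+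

text \<open>The left subtree lies strictly below the root and the right subtree, so their row sets
  are disjoint; the root shares its row with the root of the right subtree, if there is one. Columns
  are dual.\<close>

lemma planar_counts:
  "planar t \<Longrightarrow> card (set_tree t) = size t"
  "planar t \<Longrightarrow> t \<noteq> Leaf \<Longrightarrow> card (fst ` set_tree t) = Suc (left_edges t)"
  "planar t \<Longrightarrow> t \<noteq> Leaf \<Longrightarrow> card (snd ` set_tree t) = Suc (right_edges t)"
proof (induction t)
  case (Node l p r)
  {
    case 1
    then have "set_tree l \<inter> insert p (set_tree r) = {}" "p \<notin> set_tree r" by fastforce+
    then have "card (set_tree l \<union> insert p (set_tree r)) = size l + Suc (size r)"
      using Node 1 by (subst card_Un_disjoint) auto
    then show ?case by simp
  next
    case 2
    have *: "fst ` set_tree l \<inter> fst ` insert p (set_tree r) = {}" using 2 by fastforce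
    have "card (fst ` insert p (set_tree r)) = Suc (left_edges r)"
    proof (cases "r = Leaf")
      case False
      then have "fst p \<in> fst ` set_tree r"
        using 2 by (metis image_eqI planar.simps(2) value_in_set_tree)
      then show ?thesis using Node 2 False by (simp add: insert_absorb)
    qed simp
    moreover have "card (fst ` set_tree l) = (if l = Leaf then 0 else Suc (left_edges l))"
      using Node 2 by auto
    ultimately have "card (fst ` set_tree l \<union> fst ` insert p (set_tree r)) =
      (if l = Leaf then 0 else Suc (left_edges l)) + Suc (left_edges r)"
      using * by (subst card_Un_disjoint) auto
    then show ?case by (auto simp: image_Un)
  next
    case 3
    have *: "snd ` insert p (set_tree l) \<inter> snd ` set_tree r = {}" using 3 by fastforce
    have "card (snd ` insert p (set_tree l)) = Suc (right_edges l)"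
    proof (cases "l = Leaf")
      case False
      then have "snd p \<in> snd ` set_tree l"
        using 3 by (metis image_eqI planar.simps(2) value_in_set_tree)
      then show ?thesis using Node 3 False by (simp add: insert_absorb)
    qed simp
    moreover have "card (snd ` set_tree r) = (if r = Leaf then 0 else Suc (right_edges r))"
      using Node 3 by auto
    ultimately have "card (snd ` insert p (set_tree l) \<union> snd ` set_tree r) =
      Suc (right_edges l) + (if r = Leaf then 0 else Suc (right_edges r))"
      using * by (subst card_Un_disjoint) auto
    then show ?case by (auto simp: image_Un)
  }
qed auto

text \<open>This turns the order of two subtrees and a cardinality into the exact rows or columns
  that they occupy.\<close>

lemma interval_split:
  fixes a :: nat
  assumes "A \<union> B = {a..b}" "\<forall>x \<in> A. \<forall>y \<in> B. x < y" "a \<in> A"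
  shows "A = {a..<a + card A}" "B = {a + card A..b}"
proof -
  have fin: "finite A" using assms(1) by (metis finite_Un finite_atLeastAtMost)
  define m where "m = Max A"
  have m: "m \<in> A" "\<And>x. x \<in> A \<Longrightarrow> x \<le> m" unfolding m_def using fin assms(3) Max_in[of A] by (blast, simp)
  have "x \<in> A" if "a \<le> x" "x \<le> m" for x
  proof -
    have "m \<le> b" using m(1) assms(1) by (metis UnI1 atLeastAtMost_iff)
    then have "x \<in> A \<union> B" using that unfolding assms(1) by simp
    then show ?thesis using assms(2) m(1) that(2) by force
  qed
  then have A: "A = {a..m}" using m assms(1) by auto
  then have c: "a + card A = Suc m" using assms(3) by auto
  show "A = {a..<a + card A}" unfolding c using A by auto
  have "B = {a..b} - A" using assms(1,2) by fastforce
  then show "B = {a + card A..b}" unfolding c using A assms(3) by auto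
qed

text \<open>As no row or column is skipped, the order of the subtrees and their numbers of rows and
  columns fix where each one starts, and its root sits at its top-left corner.\<close>

lemma planar_eq_layout:
  assumes "planar t" "fst ` set_tree t = {r..r'}" "snd ` set_tree t = {c..c'}"
    "t \<noteq> Leaf \<Longrightarrow> value t = (r, c)"
  shows "t = layout r c t"
  using assms
proof (induction t arbitrary: r r' c c')
  case (Node a p b)
  have p: "p = (r, c)" using Node.prems by simp
  have pl: "planar a" "planar b" "planar (Node a p b)" using Node.prems(1) by auto
  have va: "snd (value a) = c" if "a \<noteq> Leaf" using Node.prems(1) p that by auto
  have vb: "fst (value b) = r" if "b \<noteq> Leaf" using Node.prems(1) p that by auto
  \<comment> \<open>The root is grouped with \<open>b\<close> for the rows and with \<open>a\<close>
    for the columns, since it shares its row with the root of \<open>b\<close> and its column with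
    the root of \<open>a\<close>.\<close>
  have U: "fst ` insert p (set_tree b) \<union> fst ` set_tree a = {r..r'}"
    "snd ` insert p (set_tree a) \<union> snd ` set_tree b = {c..c'}" using Node.prems(2,3) by auto
  have "card (fst ` insert p (set_tree b)) = Suc (left_edges b)"
  proof (cases "b = Leaf")
    case False
    then have "fst p \<in> fst ` set_tree b" using vb p by (metis fst_conv image_eqI value_in_set_tree)
    then show ?thesis using planar_counts(2)[OF pl(2) False] by (simp add: insert_absorb)
  qed simp
  then have R: "fst ` insert p (set_tree b) = {r..<r + Suc (left_edges b)}"
    "fst ` set_tree a = {r + Suc (left_edges b)..r'}"
    using interval_split[OF U(1)] pl(3) p by force+
  have "card (snd ` insert p (set_tree a)) = Suc (right_edges a)"
  proof (cases "a = Leaf")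
    case False
    then have "snd p \<in> snd ` set_tree a" using va p by (metis snd_conv image_eqI value_in_set_tree)
    then show ?thesis using planar_counts(3)[OF pl(1) False] by (simp add: insert_absorb)
  qed simp
  then have C: "snd ` insert p (set_tree a) = {c..<c + Suc (right_edges a)}"
    "snd ` set_tree b = {c + Suc (right_edges a)..c'}"
    using interval_split[OF U(2)] pl(3) p by force+
  have "a = layout (r + Suc (left_edges b)) c a"
  proof (cases "a = Leaf")
    case False
    have "snd p \<in> snd ` set_tree a" using False va p by (metis snd_conv image_eqI value_in_set_tree)
    then have "snd ` set_tree a = {c..c + right_edges a}" using C(1) by (auto simp: insert_absorb)
    moreover have "value a = (r + Suc (left_edges b), c)"
    proof -
      have "r + Suc (left_edges b) \<in> fst ` set_tree a"
        using R(2) False by (metis atLeastAtMost_iff atLeastatMost_empty_iff2 image_is_empty eq_set_tree_empty eq_refl)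
      moreover have "fst (value a) \<le> fst x" if "x \<in> set_tree a" for x
        using that planar_root_le(1)[OF pl(1)] by blast
      moreover have "fst (value a) \<ge> r + Suc (left_edges b)"
        using R(2) False by (metis atLeastAtMost_iff image_eqI value_in_set_tree)
      ultimately have "fst (value a) = r + Suc (left_edges b)" by force
      then show ?thesis using va[OF False] by (simp add: prod_eq_iff)
    qed
    ultimately show ?thesis using Node.IH(1)[OF pl(1) R(2)] by simp
  qed simp
  moreover have "b = layout r (c + Suc (right_edges a)) b"
  proof (cases "b = Leaf")
    case False
    have "fst p \<in> fst ` set_tree b" using False vb p by (metis fst_conv image_eqI value_in_set_tree)
    then have "fst ` set_tree b = {r..r + left_edges b}" using R(1) by (auto simp: insert_absorb)
    moreover have "value b = (r, c + Suc (right_edges a))"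
    proof -
      have "c + Suc (right_edges a) \<in> snd ` set_tree b"
        using C(2) False by (metis atLeastAtMost_iff atLeastatMost_empty_iff2 image_is_empty eq_set_tree_empty eq_refl)
      moreover have "snd (value b) \<le> snd x" if "x \<in> set_tree b" for x
        using that planar_root_le(2)[OF pl(2)] by blast
      moreover have "snd (value b) \<ge> c + Suc (right_edges a)"
        using C(2) False by (metis atLeastAtMost_iff image_eqI value_in_set_tree)
      ultimately have "snd (value b) = c + Suc (right_edges a)" by force
      then show ?thesis using vb[OF False] by (simp add: prod_eq_iff)
    qed
    ultimately show ?thesis using Node.IH(2)[OF pl(2) _ C(2)] by simp
  qed simp
  ultimately show ?case using p by simp
qed simp

text \<open>Outside its own subtree, a point of the left subtree can share a line only with the root
  of the whole tree, namely its column. This matters for the root of the subtree alone: any other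
  point in that column already has the subtree's root above it. The right subtree is dual.\<close>

lemma planar_points_above_left:
  assumes "planar t" "p \<in> set_tree t" "p \<noteq> value t"
  shows "((\<exists>q \<in> set_tree t. snd q = snd p \<and> fst q < fst p) \<or>
          (\<exists>q \<in> set_tree t. fst q = fst p \<and> snd q < snd p)) \<and>
         \<not> ((\<exists>q \<in> set_tree t. snd q = snd p \<and> fst q < fst p) \<and>
          (\<exists>q \<in> set_tree t. fst q = fst p \<and> snd q < snd p))"
  using assms
proof (induction t)
  case (Node l x r)
  have pl: "planar l" "planar r" using Node.prems by auto
  consider "p \<in> set_tree l" | "p \<in> set_tree r" using Node.prems by auto
  then show ?case
  proof cases
    case 1
    then have "l \<noteq> Leaf" by auto
    then have w: "value l \<in> set_tree l" "snd (value l) = snd x" "fst x < fst (value l)"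
      using Node.prems(1) by auto
    have row: "q \<in> set_tree l" if "q \<in> set_tree (Node l x r)" "fst q = fst p" for q
      using that 1 Node.prems(1) by fastforce
    have col: "q \<in> set_tree l \<or> q = x" if "q \<in> set_tree (Node l x r)" "snd q = snd p" for q
      using that 1 Node.prems(1) by fastforce
    show ?thesis
    proof (cases "p = value l")
      case True
      then have "\<not> (\<exists>q \<in> set_tree (Node l x r). fst q = fst p \<and> snd q < snd p)"
        using row planar_root_le(2)[OF pl(1)] by (metis linorder_not_le)
      moreover have "\<exists>q \<in> set_tree (Node l x r). snd q = snd p \<and> fst q < fst p"
        using True w by auto
      ultimately show ?thesis by blast
    next
      case False
      have "(\<exists>q \<in> set_tree (Node l x r). snd q = snd p \<and> fst q < fst p) \<longleftrightarrow>
        (\<exists>q \<in> set_tree l. snd q = snd p \<and> fst q < fst p)"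
      proof
        assume "\<exists>q \<in> set_tree (Node l x r). snd q = snd p \<and> fst q < fst p"
        then obtain q where q: "q \<in> set_tree (Node l x r)" "snd q = snd p" "fst q < fst p" by blast
        show "\<exists>q \<in> set_tree l. snd q = snd p \<and> fst q < fst p"
        proof (cases "q = x")
          case True
          then have "snd (value l) = snd p" using q w by simp
          moreover have "fst (value l) \<le> fst p" using planar_root_le(1)[OF pl(1) 1] .
          ultimately show ?thesis using False w(1) by (metis le_neq_implies_less prod.expand)
        next
          case False
          then show ?thesis using col q by blast
        qed
      qed auto
      moreover have "(\<exists>q \<in> set_tree (Node l x r). fst q = fst p \<and> snd q < snd p) \<longleftrightarrow>
        (\<exists>q \<in> set_tree l. fst q = fst p \<and> snd q < snd p)"
        using row by (metis UnCI tree.set(2))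
      ultimately show ?thesis using Node.IH(1)[OF pl(1) 1 False] by simp
    qed
  next
    case 2
    then have "r \<noteq> Leaf" by auto
    then have w: "value r \<in> set_tree r" "fst (value r) = fst x" "snd x < snd (value r)"
      using Node.prems(1) by auto
    have col: "q \<in> set_tree r" if "q \<in> set_tree (Node l x r)" "snd q = snd p" for q
      using that 2 Node.prems(1) by fastforce
    have row: "q \<in> set_tree r \<or> q = x" if "q \<in> set_tree (Node l x r)" "fst q = fst p" for q
      using that 2 Node.prems(1) by fastforce
    show ?thesis
    proof (cases "p = value r")
      case True
      then have "\<not> (\<exists>q \<in> set_tree (Node l x r). snd q = snd p \<and> fst q < fst p)"
        using col planar_root_le(1)[OF pl(2)] by (metis linorder_not_le)
      moreover have "\<exists>q \<in> set_tree (Node l x r). fst q = fst p \<and> snd q < snd p"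
        using True w by auto
      ultimately show ?thesis by blast
    next
      case False
      have "(\<exists>q \<in> set_tree (Node l x r). fst q = fst p \<and> snd q < snd p) \<longleftrightarrow>
        (\<exists>q \<in> set_tree r. fst q = fst p \<and> snd q < snd p)"
      proof
        assume "\<exists>q \<in> set_tree (Node l x r). fst q = fst p \<and> snd q < snd p"
        then obtain q where q: "q \<in> set_tree (Node l x r)" "fst q = fst p" "snd q < snd p" by blast
        show "\<exists>q \<in> set_tree r. fst q = fst p \<and> snd q < snd p"
        proof (cases "q = x")
          case True
          then have "fst (value r) = fst p" using q w by simp
          moreover have "snd (value r) \<le> snd p" using planar_root_le(2)[OF pl(2) 2] .
          ultimately show ?thesis using False w(1) by (metis le_neq_implies_less prod.expand)
        next
          case False
          then show ?thesis using row q by blast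
        qed
      qed auto
      moreover have "(\<exists>q \<in> set_tree (Node l x r). snd q = snd p \<and> fst q < fst p) \<longleftrightarrow>
        (\<exists>q \<in> set_tree r. snd q = snd p \<and> fst q < fst p)"
        using col by (metis UnCI tree.set(2))
      ultimately show ?thesis using Node.IH(2)[OF pl(2) 2 False] by simp
    qed
  qed
qed simp

text \<open>Two points of one row other than the root's row lie in the same subtree; the third
  point, above them and between their columns, is then forced into this subtree too.\<close>

lemma planar_no_H:
  assumes "planar t" "(r1, c2) \<in> set_tree t" "(r2, c1) \<in> set_tree t" "(r2, c3) \<in> set_tree t"
    "r1 < r2" "c1 < c2" "c2 < c3"
  shows False
  using assms
proof (induction t)
  case (Node l x r)
  have pl: "planar l" "planar r" using Node.prems by auto
  let ?a = "(r1, c2)" and ?b = "(r2, c1)" and ?c = "(r2, c3)"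
  consider "?b \<in> set_tree l \<and> ?c \<in> set_tree l" | "?b \<in> set_tree r \<and> ?c \<in> set_tree r"
    | "?b = x \<or> ?c = x"
    | "?b \<in> set_tree l \<and> ?c \<in> set_tree r" | "?b \<in> set_tree r \<and> ?c \<in> set_tree l"
    using Node.prems(3,4) by auto
  then show ?case
  proof cases
    case 1
    then have "?a \<in> set_tree l" using Node.prems by fastforce
    then show ?thesis using 1 Node.IH(1) pl Node.prems by blast
  next
    case 2
    then have "?a \<in> set_tree r" using Node.prems by fastforce
    then show ?thesis using 2 Node.IH(2) pl Node.prems by blast
  next
    case 3
    then show ?thesis using Node.prems by fastforce
  next
    case 4
    then show ?thesis using Node.prems(1) by fastforce
  next
    case 5
    then show ?thesis using Node.prems(1) by fastforce
  qed
qed simp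

text \<open>Transposing the drawing exchanges left and right subtrees and turns this into the
  argument for H.\<close>

lemma planar_no_V:
  assumes "planar t" "(r1, c2) \<in> set_tree t" "(r2, c1) \<in> set_tree t" "(r3, c2) \<in> set_tree t"
    "r1 < r2" "r2 < r3" "c1 < c2"
  shows False
  using assms
proof (induction t)
  case (Node l x r)
  have pl: "planar l" "planar r" using Node.prems by auto
  let ?a = "(r2, c1)" and ?b = "(r1, c2)" and ?c = "(r3, c2)"
  consider "?b \<in> set_tree l \<and> ?c \<in> set_tree l" | "?b \<in> set_tree r \<and> ?c \<in> set_tree r"
    | "?b = x \<or> ?c = x"
    | "?b \<in> set_tree l \<and> ?c \<in> set_tree r" | "?b \<in> set_tree r \<and> ?c \<in> set_tree l"
    using Node.prems(2,4) by auto
  then show ?case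
  proof cases
    case 1
    then have "?a \<in> set_tree l" using Node.prems by fastforce
    then show ?thesis using 1 Node.IH(1) pl Node.prems by blast
  next
    case 2
    then have "?a \<in> set_tree r" using Node.prems by fastforce
    then show ?thesis using 2 Node.IH(2) pl Node.prems by blast
  next
    case 3
    then show ?thesis using Node.prems by fastforce
  next
    case 4
    then show ?thesis using Node.prems(1) by fastforce
  next
    case 5
    then show ?thesis using Node.prems(1) by fastforce
  qed
qed simp

section \<open>Parents in a planar drawing\<close>

lemma self_in_subtrees: "t \<in> subtrees t"
  by (cases t) auto

lemma subtrees_children: "Node a p b \<in> subtrees t \<Longrightarrow> a \<in> subtrees t \<and> b \<in> subtrees t"
  by (induction t) (auto simp: self_in_subtrees)

lemma set_tree_subtrees: "s \<in> subtrees t \<Longrightarrow> set_tree s \<subseteq> set_tree t"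
  by (induction t) auto

lemma value_child_in_set_tree:
  assumes "Node a p b \<in> subtrees t"
  shows "a \<noteq> Leaf \<Longrightarrow> value a \<in> set_tree t" "b \<noteq> Leaf \<Longrightarrow> value b \<in> set_tree t"
  using subtrees_children[OF assms] set_tree_subtrees value_in_set_tree by blast+

text \<open>Being nearest is a local condition: points outside the left subtree lie above those
  inside, and points outside the right subtree lie in other columns than those inside, so the whole
  drawing adds no closer candidate.\<close>

lemma planar_parent_above:
  assumes "planar t" "Node a p b \<in> subtrees t" "w \<in> set_tree t"
  shows "snd p = snd w \<and> fst p < fst w \<and>
      (\<forall>q \<in> set_tree t. snd q = snd w \<and> fst q < fst w \<longrightarrow> fst q \<le> fst p) \<longleftrightarrow>
    a \<noteq> Leaf \<and> w = value a"
  using assms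
proof (induction t)
  case (Node l x r)
  have pl: "planar l" "planar r" using Node.prems by auto
  consider "a = l" "p = x" | "Node a p b \<in> subtrees l" | "Node a p b \<in> subtrees r"
    using Node.prems(2) by auto
  then show ?case
  proof cases
    case 1
    have l: "value l \<in> set_tree l" "snd (value l) = snd x" "fst x < fst (value l)" if "l \<noteq> Leaf"
      using that Node.prems(1) by auto
    show ?thesis unfolding 1
    proof (intro iffI conjI ballI impI; (elim conjE)?)
      assume w: "snd x = snd w" "fst x < fst w"
        "\<forall>q \<in> set_tree (Node l x r). snd q = snd w \<and> fst q < fst w \<longrightarrow> fst q \<le> fst x"
      then have wl: "w \<in> set_tree l" using Node.prems(1,3) by auto
      then show "l \<noteq> Leaf" by auto
      from l[OF this] have "\<not> fst (value l) < fst w" using w by auto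
      then show "w = value l"
        using planar_root_le(1)[OF pl(1) wl] l(2)[OF \<open>l \<noteq> Leaf\<close>] w(1) by (simp add: prod_eq_iff)
    next
      fix q assume w: "l \<noteq> Leaf" "w = value l"
      show "snd x = snd w" "fst x < fst w" using l w by auto
      assume q: "q \<in> set_tree (Node l x r)" "snd q = snd w" "fst q < fst w"
      then show "fst q \<le> fst x"
        using w l[OF w(1)] planar_root_le(1)[OF pl(1), of q] Node.prems(1) by auto
    qed
  next
    case 2
    then have p: "p \<in> set_tree l" by (metis in_set_tree_if Node_notin_subtrees_if)
    show ?thesis
    proof (cases "w \<in> set_tree l")
      case True
      have "fst q \<le> fst p" if "q \<in> set_tree (Node l x r)" "q \<notin> set_tree l" for q
        using that p Node.prems(1) by fastforce
      then have "(\<forall>q \<in> set_tree (Node l x r). snd q = snd w \<and> fst q < fst w \<longrightarrow> fst q \<le> fst p) \<longleftrightarrow>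
          (\<forall>q \<in> set_tree l. snd q = snd w \<and> fst q < fst w \<longrightarrow> fst q \<le> fst p)"
        by (metis UnCI tree.set(2))
      then show ?thesis using Node.IH(1)[OF pl(1) 2 True] by simp
    next
      case False
      then have "\<not> (snd p = snd w \<and> fst p < fst w)" using p Node.prems(1,3) by fastforce
      moreover have "w \<noteq> value a" if "a \<noteq> Leaf" using False value_child_in_set_tree(1)[OF 2 that] by metis
      ultimately show ?thesis by blast
    qed
  next
    case 3
    then have p: "p \<in> set_tree r" by (metis in_set_tree_if Node_notin_subtrees_if)
    show ?thesis
    proof (cases "w \<in> set_tree r")
      case True
      have "snd q \<noteq> snd w \<or> fst q \<le> fst p" if "q \<in> set_tree (Node l x r)" "q \<notin> set_tree r" for q
        using that p True Node.prems(1) by fastforce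
      then have "(\<forall>q \<in> set_tree (Node l x r). snd q = snd w \<and> fst q < fst w \<longrightarrow> fst q \<le> fst p) \<longleftrightarrow>
          (\<forall>q \<in> set_tree r. snd q = snd w \<and> fst q < fst w \<longrightarrow> fst q \<le> fst p)"
        by (metis UnCI tree.set(2))
      then show ?thesis using Node.IH(2)[OF pl(2) 3 True] by simp
    next
      case False
      then have "\<not> (snd p = snd w \<and> fst p < fst w)" using p Node.prems(1,3) by fastforce
      moreover have "w \<noteq> value a" if "a \<noteq> Leaf" using False value_child_in_set_tree(1)[OF 3 that] by metis
      ultimately show ?thesis by blast
    qed
  qed
qed simp

lemma planar_parent_left:
  assumes "planar t" "Node a p b \<in> subtrees t" "w \<in> set_tree t"
  shows "fst p = fst w \<and> snd p < snd w \<and>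
      (\<forall>q \<in> set_tree t. fst q = fst w \<and> snd q < snd w \<longrightarrow> snd q \<le> snd p) \<longleftrightarrow>
    b \<noteq> Leaf \<and> w = value b"
  using assms
proof (induction t)
  case (Node l x r)
  have pl: "planar l" "planar r" using Node.prems by auto
  consider "b = r" "p = x" | "Node a p b \<in> subtrees l" | "Node a p b \<in> subtrees r"
    using Node.prems(2) by auto
  then show ?case
  proof cases
    case 1
    have r: "value r \<in> set_tree r" "fst (value r) = fst x" "snd x < snd (value r)" if "r \<noteq> Leaf"
      using that Node.prems(1) by auto
    show ?thesis unfolding 1
    proof (intro iffI conjI ballI impI; (elim conjE)?)
      assume w: "fst x = fst w" "snd x < snd w"
        "\<forall>q \<in> set_tree (Node l x r). fst q = fst w \<and> snd q < snd w \<longrightarrow> snd q \<le> snd x"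
      then have wr: "w \<in> set_tree r" using Node.prems(1,3) by auto
      then show "r \<noteq> Leaf" by auto
      from r[OF this] have "\<not> snd (value r) < snd w" using w by auto
      then show "w = value r"
        using planar_root_le(2)[OF pl(2) wr] r(2)[OF \<open>r \<noteq> Leaf\<close>] w(1) by (simp add: prod_eq_iff)
    next
      fix q assume w: "r \<noteq> Leaf" "w = value r"
      show "fst x = fst w" "snd x < snd w" using r w by auto
      assume q: "q \<in> set_tree (Node l x r)" "fst q = fst w" "snd q < snd w"
      then show "snd q \<le> snd x"
        using w r[OF w(1)] planar_root_le(2)[OF pl(2), of q] Node.prems(1) by auto
    qed
  next
    case 2
    then have p: "p \<in> set_tree l" by (metis in_set_tree_if Node_notin_subtrees_if)
    show ?thesis
    proof (cases "w \<in> set_tree l")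
      case True
      have "fst q \<noteq> fst w \<or> snd q \<le> snd p" if "q \<in> set_tree (Node l x r)" "q \<notin> set_tree l" for q
        using that p True Node.prems(1) by fastforce
      then have "(\<forall>q \<in> set_tree (Node l x r). fst q = fst w \<and> snd q < snd w \<longrightarrow> snd q \<le> snd p) \<longleftrightarrow>
          (\<forall>q \<in> set_tree l. fst q = fst w \<and> snd q < snd w \<longrightarrow> snd q \<le> snd p)"
        by (metis UnCI tree.set(2))
      then show ?thesis using Node.IH(1)[OF pl(1) 2 True] by simp
    next
      case False
      then have "\<not> (fst p = fst w \<and> snd p < snd w)" using p Node.prems(1,3) by fastforce
      moreover have "w \<noteq> value b" if "b \<noteq> Leaf"
        using False value_child_in_set_tree(2)[OF 2 that] by metis
      ultimately show ?thesis by blast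
    qed
  next
    case 3
    then have p: "p \<in> set_tree r" by (metis in_set_tree_if Node_notin_subtrees_if)
    show ?thesis
    proof (cases "w \<in> set_tree r")
      case True
      have "snd q \<le> snd p" if "q \<in> set_tree (Node l x r)" "q \<notin> set_tree r" for q
        using that p Node.prems(1) by fastforce
      then have "(\<forall>q \<in> set_tree (Node l x r). fst q = fst w \<and> snd q < snd w \<longrightarrow> snd q \<le> snd p) \<longleftrightarrow>
          (\<forall>q \<in> set_tree r. fst q = fst w \<and> snd q < snd w \<longrightarrow> snd q \<le> snd p)"
        by (metis UnCI tree.set(2))
      then show ?thesis using Node.IH(2)[OF pl(2) 3 True] by simp
    next
      case False
      then have "\<not> (fst p = fst w \<and> snd p < snd w)" using p Node.prems(1,3) by fastforce
      moreover have "w \<noteq> value b" if "b \<noteq> Leaf"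
        using False value_child_in_set_tree(2)[OF 3 that] by metis
      ultimately show ?thesis by blast
    qed
  qed
qed simp

section \<open>Underlying trees of Baxter tableaux\<close>

lemma contains_HI:
  assumes "r1 < r2" "c1 < c2" "c2 < c3" "\<And>r c. r \<le> r2 \<Longrightarrow> c \<le> c3 \<Longrightarrow> (r, c) \<in> cells T"
    "(r1, c2) \<in> points T" "(r2, c1) \<in> points T" "(r2, c3) \<in> points T"
    "(r1, c3) \<notin> points T" "(r2, c2) \<notin> points T"
  shows "contains_H T"
  unfolding contains_H_def
  by (rule exI[of _ r1], rule exI[of _ r2], rule exI[of _ c1], rule exI[of _ c2], rule exI[of _ c3])
     (use assms in simp)

lemma contains_VI:
  assumes "r1 < r2" "r2 < r3" "c1 < c2" "\<And>r c. r \<le> r3 \<Longrightarrow> c \<le> c2 \<Longrightarrow> (r, c) \<in> cells T"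
    "(r1, c2) \<in> points T" "(r2, c1) \<in> points T" "(r3, c2) \<in> points T"
    "(r2, c2) \<notin> points T" "(r3, c1) \<notin> points T"
  shows "contains_V T"
  unfolding contains_V_def
  by (rule exI[of _ r1], rule exI[of _ r2], rule exI[of _ r3], rule exI[of _ c1], rule exI[of _ c2])
     (use assms in simp)

lemma tlt_finite_points: "tlt T \<Longrightarrow> finite (points T)"
  unfolding tlt_def ferrers_def by (meson finite_subset)

lemma parent_above_unique:
  assumes "p \<in> points T" "p' \<in> points T" "parent_above T p q" "parent_above T p' q"
  shows "p = p'"
proof -
  have *: "snd p = snd q" "snd p' = snd q" "fst q < fst p" "fst q < fst p'"
    using assms by (auto simp: parent_above_def points_above_def)
  have "p \<notin> points_above T p'" "p' \<notin> points_above T p"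
    using assms * unfolding parent_above_def by fastforce+
  then have "\<not> fst p < fst p'" "\<not> fst p' < fst p"
    using assms(1,2) * by (auto simp: points_above_def)
  then show ?thesis using * by (simp add: prod_eq_iff)
qed

lemma parent_left_unique:
  assumes "p \<in> points T" "p' \<in> points T" "parent_left T p q" "parent_left T p' q"
  shows "p = p'"
proof -
  have *: "fst p = fst q" "fst p' = fst q" "snd q < snd p" "snd q < snd p'"
    using assms by (auto simp: parent_left_def points_left_def)
  have "p \<notin> points_left T p'" "p' \<notin> points_left T p"
    using assms * unfolding parent_left_def by fastforce+
  then have "\<not> snd p < snd p'" "\<not> snd p' < snd p"
    using assms(1,2) * by (auto simp: points_left_def)
  then show ?thesis using * by (simp add: prod_eq_iff)
qed

section \<open>Children and descendants of a point\<close>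

lemma left_child_iff: "left_child T q = Some p \<longleftrightarrow> p \<in> points T \<and> parent_above T p q"
proof
  assume p: "p \<in> points T \<and> parent_above T p q"
  then have "left_child T q = Some (THE p. p \<in> points T \<and> parent_above T p q)"
    unfolding left_child_def by auto
  then show "left_child T q = Some p" using p left_childD parent_above_unique by metis
qed (use left_childD in blast)

lemma right_child_iff: "right_child T q = Some p \<longleftrightarrow> p \<in> points T \<and> parent_left T p q"
proof
  assume p: "p \<in> points T \<and> parent_left T p q"
  then have "right_child T q = Some (THE p. p \<in> points T \<and> parent_left T p q)"
    unfolding right_child_def by auto
  then show "right_child T q = Some p" using p right_childD parent_left_unique by metis
qed (use right_childD in blast)

lemma left_child_less: "left_child T q = Some p \<Longrightarrow> snd p = snd q \<and> fst q < fst p"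
  using left_childD[of T q p] by (auto simp: parent_above_def points_above_def)

lemma right_child_less: "right_child T q = Some p \<Longrightarrow> fst p = fst q \<and> snd q < snd p"
  using right_childD[of T q p] by (auto simp: parent_left_def points_left_def)

lemma descendants_Node:
  "finite (points T) \<Longrightarrow> descendants T p =
     Node (case left_child T p of None \<Rightarrow> Leaf | Some q \<Rightarrow> descendants T q) p
          (case right_child T p of None \<Rightarrow> Leaf | Some q \<Rightarrow> descendants T q)"
  by (subst descendants.simps) simp

lemma set_descendants:
  assumes "finite (points T)"
  shows "set_tree (descendants T p) = insert p
    ((case left_child T p of None \<Rightarrow> {} | Some q \<Rightarrow> set_tree (descendants T q)) \<union>
     (case right_child T p of None \<Rightarrow> {} | Some q \<Rightarrow> set_tree (descendants T q)))"
  by (subst descendants_Node[OF assms]) (auto split: option.splits)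

text \<open>Termination of \<open>descendants\<close> recast as induction along the child relation
  of one fixed tableau.\<close>

lemma descendants_induct [consumes 1, case_names descend]:
  assumes "finite (points T)"
    and "\<And>p. (\<And>q. left_child T p = Some q \<Longrightarrow> P q) \<Longrightarrow>
      (\<And>q. right_child T p = Some q \<Longrightarrow> P q) \<Longrightarrow> P p"
  shows "P p"
proof -
  have "S = T \<Longrightarrow> P p" for S
  proof (induction S p rule: descendants.induct)
    case (1 S p)
    then show ?case using assms by blast
  qed
  then show ?thesis by simp
qed

lemma value_descendants: "finite (points T) \<Longrightarrow> value (descendants T p) = p"
  by (simp add: descendants_Node)

lemma descendants_not_Leaf: "finite (points T) \<Longrightarrow> descendants T p \<noteq> Leaf"
  by (simp add: descendants_Node)

lemma set_descendants_subset:
  assumes "finite (points T)" "p \<in> points T"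
  shows "set_tree (descendants T p) \<subseteq> points T"
  using assms
proof (induction p rule: descendants_induct)
  case (descend p)
  then show ?case using assms(1)
    by (auto simp: set_descendants[of T p] left_child_iff right_child_iff split: option.splits)
qed

lemma descendants_ge:
  assumes "finite (points T)" "x \<in> set_tree (descendants T p)"
  shows "fst p \<le> fst x \<and> snd p \<le> snd x"
  using assms
proof (induction p rule: descendants_induct)
  case (descend p)
  then show ?case using assms(1)
    by (fastforce simp: set_descendants[of T p]
        dest: left_child_less right_child_less split: option.splits)
qed

lemma child_in_descendants:
  assumes "finite (points T)" "q \<in> set_tree (descendants T p)"
    "left_child T q = Some q' \<or> right_child T q = Some q'"
  shows "q' \<in> set_tree (descendants T p)"
  using assms
proof (induction p rule: descendants_induct)
  case (descend p)
  have "q' \<in> set_tree (descendants T q')" using assms(1) by (simp add: set_descendants)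
  then show ?case using descend assms(1)
    by (auto simp: set_descendants[of T p] split: option.splits)
qed

lemma ex_parent_above:
  assumes "finite (points T)" "points_above T p \<noteq> {}"
  obtains q where "q \<in> points T" "parent_above T p q"
proof -
  have "finite (points_above T p)" using assms(1) by (simp add: points_above_def)
  then obtain q where "q \<in> points_above T p" "\<forall>q' \<in> points_above T p. fst q' \<le> fst q"
    using obtains_MAX[of "points_above T p" fst] assms(2) by (metis Max_ge finite_imageI imageI)
  then show ?thesis using that[of q] by (simp add: parent_above_def points_above_def)
qed

lemma ex_parent_left:
  assumes "finite (points T)" "points_left T p \<noteq> {}"
  obtains q where "q \<in> points T" "parent_left T p q"
proof -
  have "finite (points_left T p)" using assms(1) by (simp add: points_left_def)
  then obtain q where "q \<in> points_left T p" "\<forall>q' \<in> points_left T p. snd q' \<le> snd q"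
    using obtains_MAX[of "points_left T p" snd] assms(2) by (metis Max_ge finite_imageI imageI)
  then show ?thesis using that[of q] by (simp add: parent_left_def points_left_def)
qed

lemma tlt_not_both:
  assumes "tlt T" "p \<in> points T"
  shows "\<not> (\<exists>q \<in> points T. \<exists>q' \<in> points T. snd q = snd p \<and> fst q < fst p \<and> fst q' = fst p \<and> snd q' < snd p)"
proof (cases "p = (0, 0)")
  case False
  then show ?thesis using assms unfolding tlt_def points_above_def points_left_def by blast
qed auto

text \<open>Every non-root point is a child of its parent, whose coordinate sum is smaller, so
  passing to parents ends at the root.\<close>

lemma set_binary_tree:
  assumes "tlt T"
  shows "set_tree (binary_tree T) = points T"
proof
  have fin: "finite (points T)" using assms by (rule tlt_finite_points)
  have root: "(0, 0) \<in> points T" using assms by (simp add: tlt_def)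
  show "set_tree (binary_tree T) \<subseteq> points T"
    unfolding binary_tree_def using set_descendants_subset[OF fin root] .
  have "p \<in> set_tree (binary_tree T)" if "p \<in> points T" for p
    using that
  proof (induction "fst p + snd p" arbitrary: p rule: less_induct)
    case less
    show ?case
    proof (cases "p = (0, 0)")
      case True
      then show ?thesis using fin by (simp add: binary_tree_def set_descendants)
    next
      case False
      then consider "points_above T p \<noteq> {}" | "points_left T p \<noteq> {}"
        using assms less.prems unfolding tlt_def by blast
      then show ?thesis
      proof cases
        case 1
        then obtain q where q: "q \<in> points T" "parent_above T p q" using ex_parent_above[OF fin] by blast
        then have "left_child T q = Some p" using less.prems by (simp add: left_child_iff)
        moreover from this have "q \<in> set_tree (binary_tree T)"
          using less.hyps[of q] q(1) left_child_less[of T q p] by linarith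
        ultimately show ?thesis unfolding binary_tree_def using child_in_descendants[OF fin] by blast
      next
        case 2
        then obtain q where q: "q \<in> points T" "parent_left T p q" using ex_parent_left[OF fin] by blast
        then have "right_child T q = Some p" using less.prems by (simp add: right_child_iff)
        moreover from this have "q \<in> set_tree (binary_tree T)"
          using less.hyps[of q] q(1) right_child_less[of T q p] by linarith
        ultimately show ?thesis unfolding binary_tree_def using child_in_descendants[OF fin] by blast
      qed
    qed
  qed
  then show "points T \<subseteq> set_tree (binary_tree T)" by blast
qed

text \<open>A right edge passing below \<open>v\<close> would form the pattern H with it.\<close>

lemma descendants_left_of:
  assumes T: "tlt T" "\<not> contains_H T"
    and "v \<in> points T" "w \<in> points T" "fst v < fst w" "snd w < snd v"
    and "x \<in> set_tree (descendants T w)"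
  shows "snd x < snd v"
  using tlt_finite_points[OF T(1)] assms(3-)
proof (induction w rule: descendants_induct)
  case (descend w)
  have fin: "finite (points T)" using T(1) by (rule tlt_finite_points)
  consider "x = w" | q where "left_child T w = Some q" "x \<in> set_tree (descendants T q)"
    | q where "right_child T w = Some q" "x \<in> set_tree (descendants T q)"
    using descend.prems(5) by (auto simp: set_descendants[OF fin, of w] split: option.splits)
  then show ?case
  proof cases
    case 1
    then show ?thesis using descend.prems by simp
  next
    case (2 q)
    then show ?thesis
      using descend.IH(1)[OF 2(1)] descend.prems left_child_less[OF 2(1)] left_childD[OF 2(1)]
      by simp
  next
    case (3 q)
    note q = right_childD[OF 3(1)] right_child_less[OF 3(1)]
    have "snd q < snd v"
    proof (rule ccontr)
      assume "\<not> snd q < snd v"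
      \<comment> \<open>In the same column, \<open>q\<close> would have \<open>v\<close> above it
        and \<open>w\<close> to its left.\<close>
      moreover have "snd q \<noteq> snd v"
        using tlt_not_both[OF T(1) q(1)] descend.prems q(3) by metis
      ultimately have less: "snd v < snd q" by simp
      \<comment> \<open>The first cell is empty since \<open>w\<close> is the nearest point to the
        left of \<open>q\<close>, the second since \<open>q\<close>, having a point to its left, has
        none above.\<close>
      have pts: "(fst w, snd v) \<notin> points T" "(fst v, snd q) \<notin> points T" "(fst w, snd q) \<in> points T"
      proof -
        show "(fst w, snd v) \<notin> points T"
          using q(2,3) less descend.prems(4) by (fastforce simp: parent_left_def points_left_def)
        show "(fst v, snd q) \<notin> points T"
          using tlt_not_both[OF T(1) q(1)] descend.prems q(3) by (metis fst_conv snd_conv)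
        show "(fst w, snd q) \<in> points T" using q by (metis prod.collapse)
      qed
      have "(fst w, snd q) \<in> cells T" using pts(3) T(1) unfolding tlt_def by blast
      moreover have "ferrers (cells T)" using T(1) by (simp add: tlt_def)
      ultimately have "(r, c) \<in> cells T" if "r \<le> fst w" "c \<le> snd q" for r c
        using ferrers_mem that by blast
      then have "contains_H T"
        using descend.prems less pts
        by (intro contains_HI[of "fst v" "fst w" "snd w" "snd v" "snd q"]) simp_all
      then show False using T(2) by simp
    qed
    then show ?thesis using descend.IH(2)[OF 3(1)] descend.prems q 3(2) by simp
  qed
qed

text \<open>Dually, a left edge on the right of \<open>v\<close> that runs from above
  \<open>v\<close> to below it would form the pattern V with it.\<close>

lemma descendants_above:
  assumes T: "tlt T" "\<not> contains_V T"
    and "v \<in> points T" "w \<in> points T" "fst w < fst v" "snd v < snd w"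
    and "x \<in> set_tree (descendants T w)"
  shows "fst x < fst v"
  using tlt_finite_points[OF T(1)] assms(3-)
proof (induction w rule: descendants_induct)
  case (descend w)
  have fin: "finite (points T)" using T(1) by (rule tlt_finite_points)
  consider "x = w" | q where "left_child T w = Some q" "x \<in> set_tree (descendants T q)"
    | q where "right_child T w = Some q" "x \<in> set_tree (descendants T q)"
    using descend.prems(5) by (auto simp: set_descendants[OF fin, of w] split: option.splits)
  then show ?case
  proof cases
    case 1
    then show ?thesis using descend.prems by simp
  next
    case (3 q)
    then show ?thesis
      using descend.IH(2)[OF 3(1)] descend.prems right_child_less[OF 3(1)] right_childD[OF 3(1)]
      by simp
  next
    case (2 q)
    note q = left_childD[OF 2(1)] left_child_less[OF 2(1)]
    have "fst q < fst v"
    proof (rule ccontr)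
      assume "\<not> fst q < fst v"
      moreover have "fst q \<noteq> fst v"
        using tlt_not_both[OF T(1) q(1)] descend.prems q(3) by metis
      ultimately have less: "fst v < fst q" by simp
      have pts: "(fst v, snd w) \<notin> points T" "(fst q, snd v) \<notin> points T" "(fst q, snd w) \<in> points T"
      proof -
        show "(fst v, snd w) \<notin> points T"
          using q(2,3) less descend.prems(3) by (fastforce simp: parent_above_def points_above_def)
        show "(fst q, snd v) \<notin> points T"
          using tlt_not_both[OF T(1) q(1)] descend.prems q(3) by (metis fst_conv snd_conv)
        show "(fst q, snd w) \<in> points T" using q by (metis prod.collapse)
      qed
      have "(fst q, snd w) \<in> cells T" using pts(3) T(1) unfolding tlt_def by blast
      moreover have "ferrers (cells T)" using T(1) by (simp add: tlt_def)
      ultimately have "(r, c) \<in> cells T" if "r \<le> fst q" "c \<le> snd w" for r c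
        using ferrers_mem that by blast
      then have "contains_V T"
        using descend.prems less pts
        by (intro contains_VI[of "fst w" "fst v" "fst q" "snd v" "snd w"]) simp_all
      then show False using T(2) by simp
    qed
    then show ?thesis using descend.IH(1)[OF 2(1)] descend.prems q 2(2) by simp
  qed
qed

text \<open>H and V bound each subtree by the root of the other one only; since no descendant lies
  above or to the left of its subtree's root, the subtrees themselves are separated.\<close>

lemma planar_descendants:
  assumes T: "tlt T" "\<not> contains_H T" "\<not> contains_V T" and "p \<in> points T"
  shows "planar (descendants T p)"
  using tlt_finite_points[OF T(1)] assms(4)
proof (induction p rule: descendants_induct)
  case (descend p)
  have fin: "finite (points T)" using T(1) by (rule tlt_finite_points)
  define l r where
    "l = (case left_child T p of None \<Rightarrow> Leaf | Some q \<Rightarrow> descendants T q)" and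
    "r = (case right_child T p of None \<Rightarrow> Leaf | Some q \<Rightarrow> descendants T q)"
  have l: "\<exists>q. left_child T p = Some q \<and> l = descendants T q \<and> q \<in> points T \<and> snd q = snd p \<and> fst p < fst q"
    if "l \<noteq> Leaf" using that left_child_less[of T p] left_childD(1)[of T p]
    by (auto simp: l_def split: option.splits)
  have r: "\<exists>q. right_child T p = Some q \<and> r = descendants T q \<and> q \<in> points T \<and> fst q = fst p \<and> snd p < snd q"
    if "r \<noteq> Leaf" using that right_child_less[of T p] right_childD(1)[of T p]
    by (auto simp: r_def split: option.splits)
  have "fst p < fst x \<and> snd p \<le> snd x" if x: "x \<in> set_tree l" for x
  proof -
    obtain q where "l = descendants T q" "snd q = snd p" "fst p < fst q"
      using l x by (cases "l = Leaf") auto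
    then show ?thesis using descendants_ge[OF fin, of x q] x by simp
  qed
  moreover have "fst p \<le> fst x \<and> snd p < snd x" if x: "x \<in> set_tree r" for x
  proof -
    obtain q where "r = descendants T q" "fst q = fst p" "snd p < snd q"
      using r x by (cases "r = Leaf") auto
    then show ?thesis using descendants_ge[OF fin, of x q] x by simp
  qed
  moreover have "fst y < fst x \<and> snd x < snd y" if x: "x \<in> set_tree l" and y: "y \<in> set_tree r" for x y
  proof -
    obtain w where w: "l = descendants T w" "w \<in> points T" "snd w = snd p" "fst p < fst w"
      using l x by (cases "l = Leaf") auto
    obtain v where v: "r = descendants T v" "v \<in> points T" "fst v = fst p" "snd p < snd v"
      using r y by (cases "r = Leaf") auto
    have "snd x < snd v" using descendants_left_of[OF T(1,2) v(2) w(2)] v w x by simp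
    moreover have "fst y < fst w" using descendants_above[OF T(1,3) w(2) v(2)] v w y by simp
    moreover have "fst w \<le> fst x" "snd v \<le> snd y"
      using descendants_ge[OF fin] x y v(1) w(1) by auto
    ultimately show ?thesis by linarith
  qed
  moreover have "planar l" "planar r" using l r descend.IH by (metis planar.simps(1))+
  moreover have "snd (value l) = snd p" if "l \<noteq> Leaf" using l[OF that] value_descendants[OF fin] by auto
  moreover have "fst (value r) = fst p" if "r \<noteq> Leaf" using r[OF that] value_descendants[OF fin] by auto
  ultimately have "planar (Node l p r)" by simp
  then show ?case using descendants_Node[OF fin, of p] by (simp add: l_def r_def)
qed

section \<open>Tableaux built on a planar drawing\<close>

lemma planar_children:
  assumes "planar t" "Node a p b \<in> subtrees t"
  shows "left_child (Tableau D (set_tree t)) p = (if a = Leaf then None else Some (value a))"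
    "right_child (Tableau D (set_tree t)) p = (if b = Leaf then None else Some (value b))"
proof -
  let ?T = "Tableau D (set_tree t)"
  have p: "p \<in> set_tree t" using in_set_tree_if[OF assms(2)] .
  have "parent_above ?T w p \<longleftrightarrow> snd p = snd w \<and> fst p < fst w \<and>
      (\<forall>q \<in> set_tree t. snd q = snd w \<and> fst q < fst w \<longrightarrow> fst q \<le> fst p)" for w
    using p unfolding parent_above_def points_above_def tableau.sel by blast
  then have "left_child ?T p = Some w \<longleftrightarrow> a \<noteq> Leaf \<and> w = value a" for w
    using planar_parent_above[OF assms, of w] value_child_in_set_tree(1)[OF assms(2)]
    unfolding left_child_iff tableau.sel by blast
  then show "left_child ?T p = (if a = Leaf then None else Some (value a))"
    by (metis not_None_eq)
  have "parent_left ?T w p \<longleftrightarrow> fst p = fst w \<and> snd p < snd w \<and>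
      (\<forall>q \<in> set_tree t. fst q = fst w \<and> snd q < snd w \<longrightarrow> snd q \<le> snd p)" for w
    using p unfolding parent_left_def points_left_def tableau.sel by blast
  then have "right_child ?T p = Some w \<longleftrightarrow> b \<noteq> Leaf \<and> w = value b" for w
    using planar_parent_left[OF assms, of w] value_child_in_set_tree(2)[OF assms(2)]
    unfolding right_child_iff tableau.sel by blast
  then show "right_child ?T p = (if b = Leaf then None else Some (value b))"
    by (metis not_None_eq)
qed

lemma descendants_planar:
  assumes "planar t" "s \<in> subtrees t" "s \<noteq> Leaf"
  shows "descendants (Tableau D (set_tree t)) (value s) = s"
  using assms(2,3)
proof (induction s)
  case (Node a p b)
  then show ?case
    using subtrees_children[OF Node.prems(1)]
    by (auto simp: descendants_Node planar_children[OF assms(1) Node.prems(1)])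
qed simp

text \<open>Supplies the preimages for surjectivity: equality of the row sets and of the column sets
  gives the point required in every row and column, planarity gives the rest.\<close>

lemma planar_tableau:
  assumes t: "planar t" "t \<noteq> Leaf" "value t = (0, 0)" and D: "ferrers D" "set_tree t \<subseteq> D"
    "fst ` D = fst ` set_tree t" "snd ` D = snd ` set_tree t"
  defines "T \<equiv> Tableau D (set_tree t)"
  shows "tlt T" "\<not> contains_H T" "\<not> contains_V T" "binary_tree T = t"
proof -
  have root: "(0, 0) \<in> set_tree t" using value_in_set_tree[OF t(2)] t(3) by simp
  have "points_above T p \<noteq> {} \<or> points_left T p \<noteq> {}"
    "\<not> (points_above T p \<noteq> {} \<and> points_left T p \<noteq> {})"
    if "p \<in> set_tree t" "p \<noteq> (0, 0)" for p
    using planar_points_above_left[OF t(1) that(1)] that(2) t(3)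
    by (auto simp: points_above_def points_left_def T_def)
  moreover have "\<exists>c. (r, c) \<in> set_tree t" if "r \<in> fst ` D" for r
    using that unfolding D(3) by force
  moreover have "\<exists>r. (r, c) \<in> set_tree t" if "c \<in> snd ` D" for c
    using that unfolding D(4) by force
  ultimately show "tlt T"
    unfolding tlt_def using D(1,2) root by (auto simp: T_def)
  show "\<not> contains_H T"
    unfolding contains_H_def T_def using planar_no_H[OF t(1)] by (metis tableau.sel(2))
  show "\<not> contains_V T"
    unfolding contains_V_def T_def using planar_no_V[OF t(1)] by (metis tableau.sel(2))
  show "binary_tree T = t"
    unfolding binary_tree_def T_def using descendants_planar[OF t(1) self_in_subtrees t(2)] t(3) by simp
qed


section \<open>The hull of a drawing\<close>

text \<open>Together with \<open>norths_leaves\<close>, this is why the offsets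
  \<open>Suc (right_edges a)\<close> and \<open>Suc (left_edges b)\<close> in \<open>layout\<close>
  count left and right leaves.\<close>

lemma easts_leaves:
  "easts (left_slot_leaves t) = Suc (right_edges t)"
  "easts (right_slot_leaves t) = (if t = Leaf then 0 else Suc (right_edges t))"
  by (induction t) auto

lemma norths_leaves:
  "norths (left_slot_leaves t) = (if t = Leaf then 0 else Suc (left_edges t))"
  "norths (right_slot_leaves t) = Suc (left_edges t)"
  by (induction t) auto

text \<open>The offsets are those of \<open>layout\<close>, so region and drawing decompose in
  parallel.\<close>

lemma region_leaves_Node:
  "(r, c) \<in> region (right_slot_leaves (Node a x b)) \<longleftrightarrow>
     Suc (left_edges b) \<le> r \<and> (r - Suc (left_edges b), c) \<in> region (right_slot_leaves a) \<or>
     Suc (right_edges a) \<le> c \<and> (r, c - Suc (right_edges a)) \<in> region (right_slot_leaves b) \<or>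
     r \<le> left_edges b \<and> c \<le> right_edges a"
proof -
  \<comment> \<open>The two slot words differ only for a leaf, where both regions are empty.\<close>
  have "region (left_slot_leaves a) = region (right_slot_leaves a)" by (cases a) auto
  then show ?thesis by (simp add: region_append easts_leaves norths_leaves less_Suc_eq_le)
qed

lemma layout_in_region:
  "p \<in> set_tree (layout r c t) \<Longrightarrow> (fst p - r, snd p - c) \<in> region (right_slot_leaves t)"
proof (induction t arbitrary: r c)
  case (Node a x b)
  consider "p = (r, c)" | "p \<in> set_tree (layout (r + Suc (left_edges b)) c a)"
    | "p \<in> set_tree (layout r (c + Suc (right_edges a)) b)" using Node.prems by auto
  then show ?case
  proof cases
    case 1
    then show ?thesis by (simp add: region_leaves_Node del: right_slot_leaves.simps)
  next
    case 2
    have "Suc (left_edges b) \<le> fst p - r" using layout_bounds(1)[OF 2] by simp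
    then show ?thesis using Node.IH(1)[OF 2]
      by (simp add: region_leaves_Node diff_diff_eq del: right_slot_leaves.simps)
  next
    case 3
    have "Suc (right_edges a) \<le> snd p - c" using layout_bounds(3)[OF 3] by simp
    then show ?thesis using Node.IH(2)[OF 3]
      by (simp add: region_leaves_Node diff_diff_eq del: right_slot_leaves.simps)
  qed
qed simp

text \<open>In the full rectangle a dominating point is found in the last column of the left
  subtree, which lies below all rows of the rectangle; if that subtree is empty, in the last row of
  the right subtree; if both are empty, at the root.\<close>

lemma layout_dominates_region:
  "(i, j) \<in> region (right_slot_leaves t) \<Longrightarrow>
     \<exists>p \<in> set_tree (layout r c t). r + i \<le> fst p \<and> c + j \<le> snd p"
proof (induction t arbitrary: r c i j)
  case (Node a x b)
  let ?A = "layout (r + Suc (left_edges b)) c a" and ?B = "layout r (c + Suc (right_edges a)) b"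
  consider "Suc (left_edges b) \<le> i" "(i - Suc (left_edges b), j) \<in> region (right_slot_leaves a)"
    | "Suc (right_edges a) \<le> j" "(i, j - Suc (right_edges a)) \<in> region (right_slot_leaves b)"
    | "i \<le> left_edges b" "j \<le> right_edges a"
    using Node.prems unfolding region_leaves_Node by blast
  then show ?case
  proof cases
    case 1
    then obtain p where "p \<in> set_tree ?A" "r + i \<le> fst p \<and> c + j \<le> snd p"
      using Node.IH(1)[OF 1(2), of "r + Suc (left_edges b)" c] by auto
    then show ?thesis by auto
  next
    case 2
    then obtain p where "p \<in> set_tree ?B" "r + i \<le> fst p \<and> c + j \<le> snd p"
      using Node.IH(2)[OF 2(2), of r "c + Suc (right_edges a)"] by auto
    then show ?thesis by auto
  next
    case 3
    show ?thesis
    proof (cases "a = Leaf")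
      case False
      have "c + right_edges a \<in> snd ` set_tree ?A" using columns_layout[OF False] by simp
      then obtain p where p: "p \<in> set_tree ?A" "snd p = c + right_edges a" by auto
      then show ?thesis using layout_bounds(1)[OF p(1)] 3 by (intro bexI[of _ p]) auto
    next
      case a: True
      show ?thesis
      proof (cases "b = Leaf")
        case False
        have "r + left_edges b \<in> fst ` set_tree ?B" using rows_layout[OF False] by simp
        then obtain p where p: "p \<in> set_tree ?B" "fst p = r + left_edges b" by auto
        then show ?thesis using layout_bounds(3)[OF p(1)] 3 by (intro bexI[of _ p]) auto
      qed (use a 3 in auto)
    qed
  qed
qed simp

lemma layout_subset_iff:
  assumes "ferrers D"
  shows "set_tree (layout 0 0 t) \<subseteq> D \<longleftrightarrow> region (right_slot_leaves t) \<subseteq> D"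
proof
  show "region (right_slot_leaves t) \<subseteq> D" if "set_tree (layout 0 0 t) \<subseteq> D"
  proof
    fix x assume "x \<in> region (right_slot_leaves t)"
    then obtain p where "p \<in> set_tree (layout 0 0 t)" "fst x \<le> fst p" "snd x \<le> snd p"
      using layout_dominates_region[of "fst x" "snd x" t 0 0] by auto
    then show "x \<in> D" using that ferrers_mem[OF assms, of "fst p" "snd p" "fst x" "snd x"] by auto
  qed
  show "set_tree (layout 0 0 t) \<subseteq> D" if "region (right_slot_leaves t) \<subseteq> D"
    using that layout_in_region[of _ 0 0 t] by fastforce
qed

lemma below_border_iff:
  assumes "length u = length v"
  shows "below (East # u @ [North]) (East # v @ [North]) \<longleftrightarrow> below u v"
proof -
  \<comment> \<open>The closing North adds no East to a prefix that runs past
    \<open>w\<close>.\<close>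
  have *: "easts (take (Suc k) (East # w @ [North])) = Suc (easts (take k w))" for k w
    by (cases "k - length w") auto
  show ?thesis
  proof
    assume "below (East # u @ [North]) (East # v @ [North])"
    then show "below u v" unfolding below_def using * by (metis Suc_le_mono)
  next
    assume b: "below u v"
    show "below (East # u @ [North]) (East # v @ [North])" unfolding below_def
    proof
      fix k
      show "easts (take k (East # v @ [North])) \<le> easts (take k (East # u @ [North]))"
        using b * by (cases k) (simp_all only: below_def take_0 Suc_le_mono order_refl)
    qed
  qed
qed


section \<open>Non-intersecting paths\<close>

lemma foldl_move: "foldl move (a, b) w = (a + int (easts w), b + int (norths w))"
proof (induction w arbitrary: a b)
  case (Cons x w)
  then show ?case by (cases x) auto
qed simp

lemma path_points_eq:
  "path_points ((a, b), w) =
     {(a + int (easts (take k w)), b + int (norths (take k w))) | k. k \<le> length w}"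
  by (simp add: path_points_def foldl_move)

text \<open>Each step raises the coordinate sum by one and both starts have the same sum, so a
  common point is reached by both paths after equally many steps. The shift \<open>d\<close> is 1
  for neighbouring paths and 2 for the outer ones.\<close>

lemma path_points_disjoint:
  assumes "length u = length v" "below u v" "d > 0"
  shows "path_points ((a, b), u) \<inter> path_points ((a - d, b + d), v) = {}"
proof -
  have False if k: "j \<le> length u" "k \<le> length v" and
    eq: "a + int (easts (take j u)) = a - d + int (easts (take k v))"
      "b + int (norths (take j u)) = b + d + int (norths (take k v))" for j k
  proof -
    have "easts (take j u) + norths (take j u) = j" "easts (take k v) + norths (take k v) = k"
      using easts_norths_take k by (metis min_absorb2)+
    then have "int j = int k" using eq by linarith
    then have "easts (take k v) \<le> easts (take j u)" using assms(2) by (simp add: below_def)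
    then show False using eq(1) assms(3) by linarith
  qed
  then show ?thesis by (auto simp: path_points_eq)
qed

text \<open>The East surplus of \<open>v\<close> over \<open>u\<close> grows by at most one per
  step; if it ever became positive it would take the value 1, and there the paths meet.\<close>

lemma below_if_disjoint:
  assumes len: "length u = length v"
    and disj: "path_points ((a, b), u) \<inter> path_points ((a - 1, b + 1), v) = {}"
  shows "below u v"
proof -
  have "easts (take k v) \<le> easts (take k u)" if "k \<le> length u" for k
    using that
  proof (induction k)
    case (Suc k)
    have "easts (take (Suc k) v) \<le> Suc (easts (take k v))"
      using Suc.prems len by (simp add: take_Suc_conv_app_nth)
    moreover have "easts (take k u) \<le> easts (take (Suc k) u)" by (rule count_take_mono) simp
    ultimately have le: "easts (take (Suc k) v) \<le> Suc (easts (take (Suc k) u))"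
      using Suc by linarith
    have "easts (take (Suc k) v) \<noteq> Suc (easts (take (Suc k) u))"
    proof
      assume e: "easts (take (Suc k) v) = Suc (easts (take (Suc k) u))"
      have "easts (take (Suc k) u) + norths (take (Suc k) u) = Suc k"
        "easts (take (Suc k) v) + norths (take (Suc k) v) = Suc k"
        using easts_norths_take Suc.prems len by (metis min_absorb2)+
      then have n: "norths (take (Suc k) u) = Suc (norths (take (Suc k) v))" using e by linarith
      have "(a + int (easts (take (Suc k) u)), b + int (norths (take (Suc k) u)))
          \<in> path_points ((a, b), u)"
        unfolding path_points_eq using Suc.prems by blast
      moreover have "(a - 1 + int (easts (take (Suc k) v)), b + 1 + int (norths (take (Suc k) v)))
          \<in> path_points ((a - 1, b + 1), v)"
        unfolding path_points_eq using Suc.prems len by auto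
      moreover have "a - 1 + int (easts (take (Suc k) v)) = a + int (easts (take (Suc k) u))"
        "b + 1 + int (norths (take (Suc k) v)) = b + int (norths (take (Suc k) u))"
        using e n by simp_all
      ultimately show False using disj by (metis IntI emptyE)
    qed
    then show ?case using le by linarith
  qed simp
  then have "easts (take (min k (length u)) v) \<le> easts (take (min k (length u)) u)" for k by simp
  moreover have "take (min k (length u)) v = take k v" "take (min k (length u)) u = take k u" for k
    using len by (auto simp: min_def)
  ultimately show ?thesis unfolding below_def by metis
qed

lemma below_trans: "below u v \<Longrightarrow> below v w \<Longrightarrow> below u w"
  unfolding below_def by (meson order_trans)

lemma nonintersecting_triples_iff:
  "(p, q, r) \<in> nonintersecting_triples n \<longleftrightarrow>
     fst p = (1, 0) \<and> fst q = (0, 1) \<and> fst r = (-1, 2) \<and> Suc (length (snd p)) = n \<and>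
     length (snd q) = length (snd p) \<and> length (snd r) = length (snd p) \<and>
     easts (snd q) = easts (snd p) \<and> easts (snd r) = easts (snd p) \<and>
     below (snd p) (snd q) \<and> below (snd q) (snd r)" (is "?L \<longleftrightarrow> ?R")
proof -
  obtain u v w where [simp]: "snd p = u" "snd q = v" "snd r = w" by auto
  note sums = easts_plus_norths[of u] easts_plus_norths[of v] easts_plus_norths[of w]
  have ends: "path_end p = (1 + int (easts u), int (norths u))"
    "path_end q = (int (easts v), 1 + int (norths v))"
    "path_end r = (-1 + int (easts w), 2 + int (norths w))"
    if "fst p = (1, 0)" "fst q = (0, 1)" "fst r = (-1, 2)"
    by (simp_all add: path_end_def that foldl_move)
  show ?thesis
  proof
    assume L: ?L
    then have s: "fst p = (1, 0)" "fst q = (0, 1)" "fst r = (-1, 2)"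
      by (auto simp: nonintersecting_triples_def)
    then have pqr: "p = ((1, 0), u)" "q = ((0, 1), v)" "r = ((-1, 2), w)"
      by (simp_all add: prod_eq_iff)
    from L obtain i where i: "i < n" "path_end p = (int n - int i, int i)"
        "path_end q = (int n - int i - 1, int i + 1)" "path_end r = (int n - int i - 2, int i + 2)"
      by (auto simp: nonintersecting_triples_def)
    have len: "Suc (length u) = n" "length v = length u" "length w = length u"
        "easts v = easts u" "easts w = easts u"
      using i ends[OF s] sums by auto
    have "below u v" using L len below_if_disjoint[of u v 1 0]
      by (simp add: nonintersecting_triples_def pqr)
    moreover have "below v w" using L len below_if_disjoint[of v w 0 1]
      by (simp add: nonintersecting_triples_def pqr)
    ultimately show ?R using s len by simp
  next
    assume R: ?R
    then have s: "fst p = (1, 0)" "fst q = (0, 1)" "fst r = (-1, 2)" by auto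
    then have pqr: "p = ((1, 0), u)" "q = ((0, 1), v)" "r = ((-1, 2), w)"
      by (simp_all add: prod_eq_iff)
    have b: "below u v" "below v w" "below u w" using R below_trans by auto
    have "path_points p \<inter> path_points q = {}" "path_points p \<inter> path_points r = {}"
        "path_points q \<inter> path_points r = {}"
      using path_points_disjoint[of u v 1 1 0] path_points_disjoint[of u w 2 1 0]
        path_points_disjoint[of v w 1 0 1] R b by (simp_all add: pqr)
    \<comment> \<open>The parameter of the endpoints is the common number of North steps.\<close>
    moreover have "norths u < n" "path_end p = (int n - int (norths u), int (norths u))"
        "path_end q = (int n - int (norths u) - 1, int (norths u) + 1)"
        "path_end r = (int n - int (norths u) - 2, int (norths u) + 2)"
      using R ends[OF s] sums by auto
    ultimately show ?L using s unfolding nonintersecting_triples_def by auto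
  qed
qed


section \<open>The bijection\<close>

text \<open>Every row and column of the diagram contains a point, so the drawing fills initial
  segments and \<open>planar_eq_layout\<close> leaves one position for each point.\<close>

lemma baxter_tlt_binary_tree:
  assumes "T \<in> baxter_tlts n"
  defines "t \<equiv> binary_tree T"
  shows "t \<noteq> Leaf" "set_tree t = points T" "t = layout 0 0 t" "size t = n"
    "num_rows (cells T) = Suc (left_edges t)" "row_length (cells T) 0 = Suc (right_edges t)"
proof -
  have T: "tlt T" "\<not> contains_H T" "\<not> contains_V T" "card (points T) = n"
    using assms(1) by (auto simp: baxter_tlts_def)
  then have fin: "finite (points T)" using tlt_finite_points by blast
  have D: "ferrers (cells T)" "points T \<subseteq> cells T" using T(1) by (auto simp: tlt_def)
  show nl: "t \<noteq> Leaf" unfolding t_def binary_tree_def by (rule descendants_not_Leaf[OF fin])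
  show set: "set_tree t = points T" unfolding t_def by (rule set_binary_tree[OF T(1)])
  have pl: "planar t" unfolding t_def binary_tree_def
    using T by (intro planar_descendants) (auto simp: tlt_def)
  have val: "value t = (0, 0)" unfolding t_def binary_tree_def by (rule value_descendants[OF fin])
  show "size t = n" using planar_counts(1)[OF pl] set T(4) by simp
  have "fst ` points T = fst ` cells T"
    using D(2) T(1) unfolding tlt_def by (auto simp: image_iff) (metis fst_conv)+
  then have rows: "fst ` set_tree t = {..<num_rows (cells T)}"
    using ferrers_fst_image[OF D(1)] set by simp
  have "snd ` points T = snd ` cells T"
    using D(2) T(1) unfolding tlt_def by (auto simp: image_iff) (metis snd_conv)+
  then have cols: "snd ` set_tree t = {..<row_length (cells T) 0}"
    using ferrers_snd_image[OF D(1)] set by simp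
  show r: "num_rows (cells T) = Suc (left_edges t)" using planar_counts(2)[OF pl nl] rows by simp
  show c: "row_length (cells T) 0 = Suc (right_edges t)" using planar_counts(3)[OF pl nl] cols by simp
  show "t = layout 0 0 t"
    using planar_eq_layout[OF pl, of 0 "left_edges t" 0 "right_edges t"] rows cols r c val
    by (simp add: lessThan_Suc_atMost atMost_atLeast0)
qed

lemma Phi_P_mem:
  assumes T: "T \<in> baxter_tlts n"
  shows "Phi_P T \<in> nonintersecting_triples n"
proof -
  let ?t = "binary_tree T"
  define u where "u = butlast (tl (se_border (cells T)))"
  note t = baxter_tlt_binary_tree[OF T]
  have D: "ferrers (cells T)" "points T \<subseteq> cells T" "cells T \<noteq> {}"
    using T by (auto simp: baxter_tlts_def tlt_def)
  have border: "se_border (cells T) = East # u @ [North]"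
    unfolding u_def by (rule se_border_shape[OF D(1,3)])
  have leaves: "right_slot_leaves ?t = East # word2 ?t @ [North]" by (rule right_slot_leaves_eq[OF t(1)])
  have E: "easts u = right_edges ?t" "norths u = left_edges ?t"
    using se_border_counts[OF D(1)] t(5,6) arg_cong[OF border, of easts] arg_cong[OF border, of norths]
    by simp_all
  have E2: "easts (word2 ?t) = right_edges ?t" "norths (word2 ?t) = left_edges ?t"
    using arg_cong[OF leaves, of easts] arg_cong[OF leaves, of norths] t(1)
    by (simp_all add: easts_leaves norths_leaves)
  have len: "length u = length (word2 ?t)"
    using E E2 easts_plus_norths[of u] easts_plus_norths[of "word2 ?t"] by simp
  \<comment> \<open>The points are the drawing, so their lying in the diagram becomes a comparison
    of two borders.\<close>
  have "set_tree (layout 0 0 ?t) \<subseteq> cells T" using t(2,3) D(2) by simp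
  then have "region (right_slot_leaves ?t) \<subseteq> region (se_border (cells T))"
    by (simp add: layout_subset_iff D(1) region_se_border)
  then have "below u (word2 ?t)"
    unfolding border leaves using E E2 len by (simp add: region_subset_iff below_border_iff)
  moreover have "Suc (length u) = n"
    using easts_plus_norths[of u] E left_plus_right_edges[OF t(1)] t(4) by simp
  ultimately show ?thesis
    using words_below[OF t(1)] len E E2
    by (simp add: Phi_P_def u_def[symmetric] nonintersecting_triples_iff)
qed

lemma Phi_P_inj: "inj_on Phi_P (baxter_tlts n)"
proof (rule inj_onI)
  fix S T assume S: "S \<in> baxter_tlts n" and T: "T \<in> baxter_tlts n" and eq: "Phi_P S = Phi_P T"
  note s = baxter_tlt_binary_tree[OF S] and t = baxter_tlt_binary_tree[OF T]
  have D: "ferrers (cells S)" "cells S \<noteq> {}" "ferrers (cells T)" "cells T \<noteq> {}"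
    using S T by (auto simp: baxter_tlts_def tlt_def)
  have "butlast (tl (se_border (cells S))) = butlast (tl (se_border (cells T)))"
    using eq by (simp add: Phi_P_def)
  then have "se_border (cells S) = se_border (cells T)"
    using se_border_shape[OF D(1,2)] se_border_shape[OF D(3,4)] by simp
  then have cells: "cells S = cells T" using region_se_border D by metis
  \<comment> \<open>Unique parsing concerns unlabelled trees; the cells come back through
    \<open>layout\<close>, which ignores labels.\<close>
  have "map_tree (\<lambda>_. ()) (binary_tree S) = map_tree (\<lambda>_. ()) (binary_tree T)"
    using eq s(1) t(1) by (intro words_inject) (simp_all add: Phi_P_def)
  then have "layout 0 0 (binary_tree S) = layout 0 0 (binary_tree T)" by (metis layout_map_tree)
  then have "points S = points T" using s(2,3) t(2,3) by metis
  then show "S = T" using cells by (simp add: tableau.expand)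
qed

lemma Phi_P_surj:
  assumes "x \<in> nonintersecting_triples n"
  obtains T where "T \<in> baxter_tlts n" "Phi_P T = x"
proof -
  obtain u v w where x: "x = (((1, 0), u), ((0, 1), v), ((-1, 2), w))"
    by (metis assms nonintersecting_triples_iff prod.collapse)
  have uvw: "Suc (length u) = n" "length v = length u" "length w = length u" "easts v = easts u"
    "easts w = easts u" "below u v" "below v w"
    using assms by (auto simp: x nonintersecting_triples_iff)
  obtain s :: "unit tree" where s: "s \<noteq> Leaf" "word1 s = w" "word2 s = v"
    using words_surj[of w v] uvw by metis
  define t where "t = layout 0 0 s"
  \<comment> \<open>\<open>s\<close> and \<open>t\<close> differ only in their labels, which
    \<open>layout\<close> ignores, so \<open>t\<close> is its own layout.\<close>
  have ts: "t = layout 0 0 t" unfolding t_def by (metis layout_map_tree map_tree_layout)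
  have shape: "map_tree (\<lambda>_. ()) t = s" unfolding t_def map_tree_layout by (induction s) auto
  have words: "word1 t = w" "word2 t = v" "left_edges t = left_edges s" "right_edges t = right_edges s"
    using s(2,3) shape words_map_tree by (metis, metis, metis left_edges_map_tree, metis right_edges_map_tree)
  have t: "t \<noteq> Leaf" "planar t" "value t = (0, 0)"
    using s(1) by (simp_all add: t_def planar_layout)
  define b where "b = East # u @ [North]"
  define T where "T = Tableau (region b) (set_tree t)"
  note R = region_border[OF b_def]
  have leaves: "right_slot_leaves t = East # v @ [North]"
    using right_slot_leaves_eq[OF t(1)] words by simp
  have E: "easts u = right_edges t" "norths u = left_edges t"
    using arg_cong[OF leaves, of easts] arg_cong[OF leaves, of norths] t(1) uvw
      easts_plus_norths[of u] easts_plus_norths[of v]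
    by (simp_all add: easts_leaves norths_leaves)
  have "region (right_slot_leaves t) \<subseteq> region b"
    unfolding leaves b_def using uvw by (subst region_subset_iff) (simp_all add: below_border_iff)
  then have sub: "set_tree t \<subseteq> region b"
    using layout_subset_iff[OF R(1), of t] ts by simp
  have rows: "fst ` region b = fst ` set_tree t"
    using R(2) rows_layout[OF t(1), of 0 0] ts E by (auto simp: b_def)
  have cols: "snd ` region b = snd ` set_tree t"
    using R(3) columns_layout[OF t(1), of 0 0] ts E by (auto simp: b_def)
  note T = planar_tableau[OF t(2,1,3) R(1) sub rows cols, folded T_def]
  have "card (points T) = n"
    using planar_counts(1)[OF t(2)] left_plus_right_edges[OF t(1)] E uvw(1) easts_plus_norths[of u]
    by (simp add: T_def)
  then have "T \<in> baxter_tlts n" using T by (simp add: baxter_tlts_def)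
  moreover have "Phi_P T = x"
    using T(4) words se_border_region[OF b_def] by (simp add: Phi_P_def x T_def b_def)
  ultimately show ?thesis by (rule that)
qed

theorem theorem5p4:
  fixes n :: nat
  assumes "n > 0"
  shows "bij_betw Phi_P (baxter_tlts n) (nonintersecting_triples n)"
  unfolding bij_betw_def using Phi_P_inj Phi_P_mem Phi_P_surj
  by (metis image_eqI image_subsetI subsetI subset_antisym)

end
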